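(* Let $G$ be a plane bipartite graph with vertex classes $U,V$, and let distinct vertices $a_1, a_2, \ldots, a_n, b_n, b_{n-1}, \ldots, b_1$ appear in this cyclic order on a face of $G$. Let $A=\{a_1,\ldots,a_n\}$, $B=\{b_1,\ldots,b_n\}$, $L=G-(A\cap U)-(B\cap V)$ and $K=G-(A\cap V)-(B\cap U)$. For $1\le i,j\le n$ define $L_{ij}$ by: (i) if $a_i,b_j\in U$, $L_{ij}$ is the subgraph of $G$ induced by $(V(L)\setminus\{b_j\})\cup\{a_i\}$; (ii) if $a_i\in U$, $b_j\in V$, $L_{ij}$ is induced by $V(L)\cup\{a_i,b_j\}$; (iii) if $a_i\in V$, $b_j\in U$, $L_{ij}=L-a_i-b_j$; (iv) if $a_i,b_j\in V$, $L_{ij}$ is induced by $(V(L)\setminus\{a_i\})\cup\{b_j\}$. If $L$ has exactly one perfect matching, then \[ M(K) = \det\big[M(L_{ij})\big]_{i,j=1}^n. \]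
   Context: $M(\Gamma)$ is the number of perfect matchings of a graph $\Gamma$; for a set $S$ of vertices, $G-S$ is the subgraph of $G$ induced by the vertices not in $S$. *)

theory Defs
  imports "HOL-Analysis.Analysis" "Jordan_Normal_Form.Determinant"
begin

text \<open>
  Vertices are points of the plane and edges are point sets, namely arcs. Edges are told apart by
  their point sets only, so parallel edges are allowed; loops are not. The ends of an edge
  \<open>e\<close> are the points of \<open>e\<close> that are vertices.
\<close>

record graph =
  vertices :: "complex set"
  edges :: "complex set set"

definition plane_graph :: "graph \<Rightarrow> bool" where
  "plane_graph G \<longleftrightarrow>
     finite (vertices G) \<and> finite (edges G) \<and>
     (\<forall>e\<in>edges G. \<exists>g. arc g \<and> path_image g = e \<and>
        e \<inter> vertices G = {pathstart g, pathfinish g}) \<and>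
     (\<forall>e\<in>edges G. \<forall>f\<in>edges G. e \<noteq> f \<longrightarrow> e \<inter> f \<subseteq> vertices G)"

definition faces :: "graph \<Rightarrow> complex set set" where
  "faces G = components (- (vertices G \<union> \<Union> (edges G)))"

definition bipartite :: "graph \<Rightarrow> complex set \<Rightarrow> complex set \<Rightarrow> bool" where
  "bipartite G U V \<longleftrightarrow>
     U \<union> V = vertices G \<and> U \<inter> V = {} \<and>
     (\<forall>e\<in>edges G. \<exists>u\<in>U. \<exists>v\<in>V. e \<inter> vertices G = {u, v})"

definition induced_subgraph :: "graph \<Rightarrow> complex set \<Rightarrow> graph" where
  "induced_subgraph G W =
     \<lparr>vertices = vertices G \<inter> W, edges = {e \<in> edges G. e \<inter> vertices G \<subseteq> W}\<rparr>"

definition delete_vertices :: "graph \<Rightarrow> complex set \<Rightarrow> graph" where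
  "delete_vertices G S = induced_subgraph G (vertices G - S)"

definition perfect_matching :: "graph \<Rightarrow> complex set set \<Rightarrow> bool" where
  "perfect_matching G P \<longleftrightarrow> P \<subseteq> edges G \<and> (\<forall>v\<in>vertices G. \<exists>!e. e \<in> P \<and> v \<in> e)"

definition num_perfect_matchings :: "graph \<Rightarrow> nat" where
  "num_perfect_matchings G = card {P. perfect_matching G P}"

text \<open>
  The vertices \<open>xs\<close> appear in this cyclic order on the face \<open>F\<close> if some closed disc, contained
  in \<open>F\<close> except for the points \<open>xs\<close>, has these points on its boundary in this cyclic order.
  Touching a vertex with the disc amounts to choosing one of its occurrences on the boundary walk
  of \<open>F\<close>, so this also makes sense for a vertex that the walk meets several times. The
  parametrisation \<open>h\<close> may preserve or reverse orientation: the order may be read clockwise or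
  anticlockwise. It is only the cyclic order that matters, as \<open>h\<close> may be composed with a rotation.
\<close>

definition in_cyclic_order_on_face :: "complex list \<Rightarrow> complex set \<Rightarrow> bool" where
  "in_cyclic_order_on_face xs F \<longleftrightarrow>
     (\<exists>(h :: complex \<Rightarrow> complex) (t :: nat \<Rightarrow> real).
        continuous_on (cball 0 1) h \<and> inj_on h (cball 0 1) \<and>
        strict_mono_on {..<length xs} t \<and>
        (\<forall>k<length xs. 0 \<le> t k \<and> t k < 2 * pi \<and> h (cis (t k)) = xs ! k) \<and>
        h ` (cball 0 1 - (\<lambda>k. cis (t k)) ` {..<length xs}) \<subseteq> F)"

definition graph_L :: "graph \<Rightarrow> complex set \<Rightarrow> complex set \<Rightarrow> complex set \<Rightarrow> complex set \<Rightarrow> graph" where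
  "graph_L G U V A B = delete_vertices (delete_vertices G (A \<inter> U)) (B \<inter> V)"

definition graph_K :: "graph \<Rightarrow> complex set \<Rightarrow> complex set \<Rightarrow> complex set \<Rightarrow> complex set \<Rightarrow> graph" where
  "graph_K G U V A B = delete_vertices (delete_vertices G (A \<inter> V)) (B \<inter> U)"

text \<open>
  For \<open>a = a\<^sub>i\<close> and \<open>b = b\<^sub>j\<close> this is \<open>L\<^sub>i\<^sub>j\<close>; since \<open>U\<close> and \<open>V\<close> partition the vertices, the four
  branches are exactly the cases \<open>a, b \<in> U\<close>; \<open>a \<in> U, b \<in> V\<close>; \<open>a \<in> V, b \<in> U\<close>; \<open>a, b \<in> V\<close>.
\<close>

definition graph_L_entry ::
  "graph \<Rightarrow> complex set \<Rightarrow> complex set \<Rightarrow> complex set \<Rightarrow> complex set \<Rightarrow> complex \<Rightarrow> complex \<Rightarrow> graph" where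
  "graph_L_entry G U V A B a b =
     (let L = graph_L G U V A B in
      if a \<in> U \<and> b \<in> U then induced_subgraph G ((vertices L - {b}) \<union> {a})
      else if a \<in> U \<and> b \<in> V then induced_subgraph G (vertices L \<union> {a, b})
      else if a \<in> V \<and> b \<in> U then delete_vertices L {a, b}
      else induced_subgraph G ((vertices L - {a}) \<union> {b}))"

end

theory Submission
  imports Defs "HOL-Combinatorics.Cycles"
begin

text \<open>
  Orient the edges of the unique perfect matching \<open>\<mu>\<close> of \<open>L\<close> from \<open>V\<close> to \<open>U\<close> and all other edges
  from \<open>U\<close> to \<open>V\<close>. Taking the symmetric difference with \<open>\<mu>\<close> turns the perfect matchings of \<open>K\<close> into
  the systems of vertex-disjoint directed paths and cycles in which the paths lead from the
  \<open>a\<^sub>i\<close> to the \<open>b\<^sub>j\<close>, and those of \<open>L\<^sub>i\<^sub>j\<close> into such systems with a single path, from \<open>a\<^sub>i\<close>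
  to \<open>b\<^sub>j\<close>.
  A directed cycle could be used to change \<open>\<mu>\<close>, so uniqueness of \<open>\<mu>\<close> excludes cycles. By planarity,
  disjoint paths must lead from each \<open>a\<^sub>i\<close> to \<open>b\<^sub>i\<close>. This is the situation of the
  Lindstroem-Gessel-Viennot lemma with only the identity permutation contributing.

  That lemma is obtained from Leibniz' formula. Let \<open>F = I - N\<close> with \<open>N\<close> the adjacency matrix.
  Without cycles \<open>det F = 1\<close>. Replacing row \<open>b\<^sub>i\<close> of \<open>F\<close> by the unit vector of \<open>a\<^sub>i\<close> gives a matrix
  whose nonzero Leibniz terms are the path systems, closed up to permutations by \<open>b\<^sub>i \<mapsto> a\<^sub>i\<close>, all
  with total sign \<open>+1\<close>. Multiplying it by \<open>P = F\<^sup>-\<^sup>1\<close> leaves unit rows except for the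
  rows \<open>P(a\<^sub>i, \<cdot>)\<close>. So the number of path systems is \<open>det [P(a\<^sub>i, b\<^sub>j)]\<close>, and the case of one
  path identifies the entries.
\<close>

section \<open>Determinants over finite index sets\<close>

text \<open>Rows and columns are indexed by a finite set, so that matrices can be indexed by the
  nodes of a graph directly.\<close>

definition set_det :: "'a set \<Rightarrow> ('a \<Rightarrow> 'a \<Rightarrow> 'b) \<Rightarrow> 'b :: comm_ring_1" where
  "set_det S F = (\<Sum>p | p permutes S. of_int (sign p) * (\<Prod>x\<in>S. F x (p x)))"

lemma set_det_cong:
  assumes "\<And>x y. x \<in> S \<Longrightarrow> y \<in> S \<Longrightarrow> F x y = G x y"
  shows "set_det S F = set_det S G"
proof -
  have "(\<Prod>x\<in>S. F x (p x)) = (\<Prod>x\<in>S. G x (p x))" if "p permutes S" for p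
    using assms permutes_in_image[OF that] by (intro prod.cong) auto
  then show ?thesis unfolding set_det_def by (intro sum.cong) auto
qed

lemma set_det_reindex:
  assumes "bij_betw f A B" and "finite A"
  shows "set_det B F = set_det A (\<lambda>x y. F (f x) (f y))"
proof -
  have inj: "inj_on f A" and im: "f ` A = B"
    using assms(1) by (auto simp: bij_betw_def)
  have bij: "bij_betw (map_permutation A f) {p. p permutes A} {p. p permutes B}"
  proof (rule bij_betw_byWitness[where f' = "map_permutation B (inv_into A f)"])
    show "\<forall>p\<in>{p. p permutes A}. map_permutation B (inv_into A f) (map_permutation A f p) = p"
      using assms(1) inj by (auto intro: map_permutation_compose_inv)
    show "\<forall>p\<in>{p. p permutes B}. map_permutation A f (map_permutation B (inv_into A f) p) = p"
      using bij_betw_inv_into[OF assms(1)] im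
      by (auto intro!: map_permutation_compose_inv simp: f_inv_into_f)
    show "map_permutation A f ` {p. p permutes A} \<subseteq> {p. p permutes B}"
      using map_permutation_permutes[OF assms(1)] by auto
    show "map_permutation B (inv_into A f) ` {p. p permutes B} \<subseteq> {p. p permutes A}"
      using map_permutation_permutes[OF bij_betw_inv_into[OF assms(1)]] by auto
  qed
  have "set_det B F = (\<Sum>p | p permutes A. of_int (sign (map_permutation A f p)) *
      (\<Prod>x\<in>B. F x (map_permutation A f p x)))"
    unfolding set_det_def by (rule sum.reindex_bij_betw[OF bij, symmetric])
  also have "\<dots> = set_det A (\<lambda>x y. F (f x) (f y))"
    unfolding set_det_def
  proof (rule sum.cong[OF refl])
    fix p assume "p \<in> {p. p permutes A}"
    then have p: "p permutes A" by simp
    have "(\<Prod>x\<in>B. F x (map_permutation A f p x)) = (\<Prod>x\<in>A. F (f x) (f (p x)))"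
      unfolding im[symmetric] prod.reindex[OF inj] o_def
      by (rule prod.cong[OF refl]) (simp add: map_permutation_apply inj)
    then show "of_int (sign (map_permutation A f p)) * (\<Prod>x\<in>B. F x (map_permutation A f p x)) =
        of_int (sign p) * (\<Prod>x\<in>A. F (f x) (f (p x)))"
      using sign_map_permutation[OF inj p assms(2)] by simp
  qed
  finally show ?thesis .
qed

lemma set_det_eq_det:
  "set_det {0..<n} F = Determinant.det (Matrix.mat n n (\<lambda>(i, j). F i j))"
proof -
  have "(\<Prod>x\<in>{0..<n}. F x (p x)) = (\<Prod>i = 0..<n. Matrix.mat n n (\<lambda>(i, j). F i j) $$ (i, p i))"
    if "p permutes {0..<n}" for p
    using that by (intro prod.cong) (auto dest: permutes_in_image[of p _ ])
  then show ?thesis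
    unfolding set_det_def
    by (subst det_def'[where n = n]) (auto intro!: sum.cong simp: sign_def)
qed

lemma set_det_enum:
  assumes "bij_betw f {0..<n} S"
  shows "set_det S F = Determinant.det (Matrix.mat n n (\<lambda>(i, j). F (f i) (f j)))"
  by (subst set_det_reindex[OF assms]) (simp_all add: set_det_eq_det)

lemma set_det_mult:
  assumes "finite S"
  shows "set_det S (\<lambda>x y. \<Sum>z\<in>S. F x z * G z y) = set_det S F * set_det S G"
proof -
  obtain f where f: "bij_betw f {0..<card S} S"
    using ex_bij_betw_nat_finite[OF assms] by blast
  let ?n = "card S"
  let ?A = "Matrix.mat ?n ?n (\<lambda>(i, j). F (f i) (f j))"
  let ?B = "Matrix.mat ?n ?n (\<lambda>(i, j). G (f i) (f j))"
  have "?A * ?B = Matrix.mat ?n ?n (\<lambda>(i, j). \<Sum>z\<in>S. F (f i) z * G z (f j))"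
    by (rule eq_matI)
      (auto simp: scalar_prod_def sum.reindex_bij_betw[OF f, symmetric] intro!: sum.cong)
  then show ?thesis
    by (simp add: set_det_enum[OF f] det_mult[of _ ?n, symmetric])
qed

text \<open>The adjugate is an inverse over the ring itself once the determinant is 1, so integer
  entries stay integral.\<close>

lemma right_inverse_if_set_det_eq_1:
  assumes "finite S" and "set_det S F = 1"
  obtains P where "\<And>x y. x \<in> S \<Longrightarrow> y \<in> S \<Longrightarrow> (\<Sum>z\<in>S. F x z * P z y) = of_bool (x = y)"
proof -
  obtain f where f: "bij_betw f {0..<card S} S"
    using ex_bij_betw_nat_finite[OF assms(1)] by blast
  let ?n = "card S"
  let ?A = "Matrix.mat ?n ?n (\<lambda>(i, j). F (f i) (f j))"
  define Q where "Q = adj_mat ?A"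
  define g where "g = inv_into {0..<?n} f"
  have Q: "Q \<in> carrier_mat ?n ?n" "?A * Q = 1\<^sub>m ?n"
    using adj_mat[of ?A ?n] assms(2) set_det_enum[OF f, of F]
    by (auto simp: Q_def)
  have g: "g x \<in> {0..<?n}" "f (g x) = x" if "x \<in> S" for x
    using that f bij_betw_inv_into_right[OF f] bij_betw_apply[OF bij_betw_inv_into[OF f]]
    by (auto simp: g_def)
  have gf: "g (f i) = i" if "i < ?n" for i
    using that f by (simp add: g_def bij_betw_inv_into_left)
  show thesis
  proof (rule that[of "\<lambda>z y. Q $$ (g z, g y)"])
    fix x y assume xy: "x \<in> S" "y \<in> S"
    have "(\<Sum>z\<in>S. F x z * Q $$ (g z, g y)) = (\<Sum>k = 0..<?n. F x (f k) * Q $$ (k, g y))"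
      by (simp add: sum.reindex_bij_betw[OF f, symmetric] gf)
    also have "\<dots> = (?A * Q) $$ (g x, g y)"
      using g[OF xy(1)] g[OF xy(2)] Q(1)
      by (auto simp: scalar_prod_def intro!: sum.cong)
    also have "\<dots> = of_bool (x = y)"
      using g(1)[OF xy(1)] g(1)[OF xy(2)] g(2)[OF xy(1)] g(2)[OF xy(2)] unfolding Q(2)
      by (simp add: one_mat_def) metis
    finally show "(\<Sum>z\<in>S. F x z * Q $$ (g z, g y)) = of_bool (x = y)" .
  qed
qed

text \<open>A permutation moving a point outside \<open>B\<close> picks a zero from a unit row, so
  only permutations of \<open>B\<close> contribute.\<close>

lemma set_det_unit_rows:
  assumes "finite S" and "B \<subseteq> S"
    and unit: "\<And>x y. x \<in> S - B \<Longrightarrow> y \<in> S \<Longrightarrow> F x y = of_bool (x = y)"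
  shows "set_det S F = set_det B F"
proof -
  have "set_det S F = (\<Sum>p | p permutes B. of_int (sign p) * (\<Prod>x\<in>S. F x (p x)))"
    unfolding set_det_def
  proof (rule sum.mono_neutral_right)
    show "finite {p. p permutes S}" using assms(1) by (rule finite_permutations)
    show "{p. p permutes B} \<subseteq> {p. p permutes S}"
      using assms(2) by (auto intro: permutes_subset)
    show "\<forall>p\<in>{p. p permutes S} - {p. p permutes B}. of_int (sign p) * (\<Prod>x\<in>S. F x (p x)) = 0"
    proof
      fix p assume "p \<in> {p. p permutes S} - {p. p permutes B}"
      then have p: "p permutes S" "\<not> p permutes B" by auto
      then obtain x where "x \<in> S - B" "p x \<noteq> x"
        using permutes_superset[OF p(1), of B] by blast
      then have "F x (p x) = 0"
        using unit[of x "p x"] permutes_in_image[OF p(1), of x] by auto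
      with \<open>x \<in> S - B\<close> show "of_int (sign p) * (\<Prod>x\<in>S. F x (p x)) = 0"
        using prod_zero[OF assms(1), of "\<lambda>x. F x (p x)"] by (metis DiffD1 mult_zero_right)
    qed
  qed
  also have "\<dots> = set_det B F"
    unfolding set_det_def
  proof (rule sum.cong[OF refl])
    fix p assume "p \<in> {p. p permutes B}"
    then have p: "p permutes B" by simp
    have "(\<Prod>x\<in>S. F x (p x)) = (\<Prod>x\<in>B. F x (p x))"
      using assms(1,2) unit permutes_not_in[OF p]
      by (intro prod.mono_neutral_right) auto
    then show "of_int (sign p) * (\<Prod>x\<in>S. F x (p x)) = of_int (sign p) * (\<Prod>x\<in>B. F x (p x))"
      by simp
  qed
  finally show ?thesis .
qed

text \<open>
  The function \<open>g\<close> is constant on the cycles of \<open>p\<close>, so no cycle has two elements in \<open>I\<close>; the last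
  assumption says that every nontrivial cycle has one. The proof removes the successor of an
  element of \<open>I\<close> from its cycle, which changes both sides by a sign.
\<close>

lemma sign_eq_if_cycles_meet_once:
  assumes "finite S" and "p permutes S" and "I \<subseteq> S"
    and "\<And>x. x \<in> S \<Longrightarrow> g (p x) = g x" and "inj_on g I"
    and "\<And>C x. C \<subseteq> S - I \<Longrightarrow> p ` C \<subseteq> C \<Longrightarrow> x \<in> C \<Longrightarrow> p x = x"
  shows "sign p = (-1) ^ card {x \<in> S - I. p x \<noteq> x}"
  using assms(2,4,6)
proof (induction "card {x \<in> S - I. p x \<noteq> x}" arbitrary: p rule: less_induct)
  case less
  note p = less.prems(1)
  show ?case
  proof (cases "\<forall>i\<in>I. p i = i")
    case True
    \<comment> \<open>By injectivity, a permutation fixing \<open>I\<close> pointwise preserves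
      \<open>S - I\<close>, which then consists of fixed points.\<close>
    have "p x \<in> S - I" if "x \<in> S - I" for x
      using that True permutes_in_image[OF p, of x] inj_eq[OF permutes_inj[OF p], of "p x" x] by auto
    then have "p x = x" if "x \<in> S - I" for x
      using that less.prems(3)[of "S - I" x] by blast
    then have "p = id" using True permutes_not_in[OF p] by (auto simp: fun_eq_iff)
    then show ?thesis by (simp add: sign_id)
  next
    case False
    then obtain i where i: "i \<in> I" "p i \<noteq> i" by blast
    define x where "x = p i"
    have iS: "i \<in> S" using i assms(3) by blast
    then have xS: "x \<in> S" using permutes_in_image[OF p] by (simp add: x_def)
    have xI: "x \<notin> I"
      using less.prems(2)[OF iS] assms(5) i by (auto simp: x_def dest: inj_onD)
    have px: "p x \<noteq> x"
      using i inj_eq[OF permutes_inj[OF p], of x i] by (auto simp: x_def)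
    define q where "q = p \<circ> Transposition.transpose i x"
    have q: "q permutes S"
      unfolding q_def by (intro permutes_compose permutes_swap_id iS xS p)
    have q_simps: "q x = x" "q i = p x" "\<And>y. y \<noteq> i \<Longrightarrow> y \<noteq> x \<Longrightarrow> q y = p y"
      by (auto simp: q_def x_def Transposition.transpose_def)
    have sets: "{y \<in> S - I. p y \<noteq> y} = insert x {y \<in> S - I. q y \<noteq> y}"
      using xI xS px i q_simps by (auto, metis, metis)
    have fin: "finite {y \<in> S - I. q y \<noteq> y}" using assms(1) by simp
    have card: "card {y \<in> S - I. p y \<noteq> y} = Suc (card {y \<in> S - I. q y \<noteq> y})"
      unfolding sets using fin q_simps(1) by (subst card_insert_disjoint) auto
    have "sign q = (-1) ^ card {y \<in> S - I. q y \<noteq> y}"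
    proof (rule less.hyps)
      show "card {y \<in> S - I. q y \<noteq> y} < card {y \<in> S - I. p y \<noteq> y}" using card by simp
      show "q permutes S" by (rule q)
      show "g (q y) = g y" if "y \<in> S" for y
        using that less.prems(2) q_simps xS iS x_def by metis
      fix C y assume C: "C \<subseteq> S - I" "q ` C \<subseteq> C" "y \<in> C"
      have iC: "i \<notin> C" using C i by auto
      show "q y = y"
      proof (cases "y = x")
        case False
        \<comment> \<open>On \<open>C - {x}\<close> the maps \<open>p\<close> and \<open>q\<close>
          agree because \<open>i\<close> is not in \<open>C\<close>, and \<open>p\<close> takes the
          value \<open>x\<close> only at \<open>i\<close>.\<close>
        have "p ` (C - {x}) \<subseteq> C - {x}"
        proof
          fix w assume "w \<in> p ` (C - {x})"
          then obtain z where z: "z \<in> C" "z \<noteq> x" "w = p z" by auto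
          then have "w = q z" using q_simps iC by metis
          moreover have "w \<noteq> x"
            using z iC inj_eq[OF permutes_inj[OF p], of z i] by (auto simp: x_def)
          ultimately show "w \<in> C - {x}" using z C by auto
        qed
        then have "p y = y" using less.prems(3)[of "C - {x}" y] C False by auto
        then show ?thesis using q_simps False iC C(3) by metis
      qed (use q_simps in simp)
    qed
    moreover have "sign q = - sign p"
      using i permutes_imp_permutation[OF assms(1) p] 
      by (auto simp: q_def sign_compose permutation_swap_id sign_swap_id x_def)
    ultimately show ?thesis using card by (simp add: minus_equation_iff)
  qed
qed

section \<open>The Lindstroem-Gessel-Viennot lemma for noncrossing end points\<close>

text \<open>
  A linking encodes disjoint paths from the points \<open>s b\<close> to points of \<open>B\<close>, and possibly disjoint
  cycles, as a permutation: \<open>p x\<close> is the successor of \<open>x\<close> on its path or cycle, unused points are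
  fixed, and each end point \<open>b \<in> B\<close> is sent back to the start \<open>s b\<close>.
\<close>

definition linkings :: "'a set \<Rightarrow> ('a \<Rightarrow> 'a \<Rightarrow> bool) \<Rightarrow> 'a set \<Rightarrow> ('a \<Rightarrow> 'a) \<Rightarrow> ('a \<Rightarrow> 'a) set" where
  "linkings N R B s =
     {p. p permutes N \<and> (\<forall>x\<in>B. p x = s x) \<and> (\<forall>x\<in>N - B. p x = x \<or> R x (p x))}"

lemma linkings_permutes: "p \<in> linkings N R B s \<Longrightarrow> p permutes N"
  by (simp add: linkings_def)

lemma linkings_cong:
  assumes "\<And>x. x \<in> B \<Longrightarrow> s x = t x"
  shows "linkings N R B s = linkings N R B t"
  using assms by (auto simp: linkings_def)

text \<open>A union of cycles of \<open>p\<close> avoiding \<open>B\<close> is itself a linking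
  without paths, hence trivial. So every nontrivial cycle meets \<open>B\<close>, and by
  \<open>once\<close> in a single point.\<close>

lemma sign_linking:
  assumes "finite N" and "B \<subseteq> N" and trivial: "linkings N R {} t = {id}"
    and p: "p \<in> linkings N R B s"
    and once: "\<And>x y k. x \<in> B \<Longrightarrow> y \<in> B \<Longrightarrow> (p ^^ k) x = y \<Longrightarrow> x = y"
  shows "sign p = (-1) ^ card {x \<in> N - B. p x \<noteq> x}"
proof (rule sign_eq_if_cycles_meet_once)
  show pN: "p permutes N" using p by (rule linkings_permutes)
  \<comment> \<open>The orbit of a point under \<open>p\<close>; nonnegative powers give all of it
    since \<open>p\<close> has finite order.\<close>
  define g where "g = (\<lambda>x. {(p ^^ k) x |k. True})"
  show "inj_on g B"
  proof (rule inj_onI)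
    fix x y assume xy: "x \<in> B" "y \<in> B" "g x = g y"
    have "(p ^^ 0) y \<in> g y" unfolding g_def by blast
    then have "y \<in> g x" using xy(3) by simp
    then obtain k where "(p ^^ k) x = y" by (auto simp: g_def)
    then show "x = y" by (rule once[OF xy(1,2)])
  qed
  show "g (p x) = g x" for x
  proof
    show "g (p x) \<subseteq> g x"
    proof
      fix y assume "y \<in> g (p x)"
      then obtain k where "y = (p ^^ k) (p x)" by (auto simp: g_def)
      then have "y = (p ^^ Suc k) x" by (simp add: funpow_swap1)
      then show "y \<in> g x" unfolding g_def by blast
    qed
    obtain m where m: "p ^^ m = id" "m > 0"
      using permutation_is_nilpotent[OF permutes_imp_permutation[OF assms(1) pN]] by auto
    then obtain m' where m': "m = Suc m'" by (cases m) auto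
    show "g x \<subseteq> g (p x)"
    proof
      fix y assume "y \<in> g x"
      then obtain k where k: "y = (p ^^ k) x" by (auto simp: g_def)
      have "(p ^^ m') (p x) = x" using m m' by (simp add: funpow_swap1 fun_eq_iff)
      then have "y = (p ^^ (k + m')) (p x)" using k by (simp add: funpow_add)
      then show "y \<in> g (p x)" unfolding g_def by blast
    qed
  qed
  fix C x assume C: "C \<subseteq> N - B" "p ` C \<subseteq> C" "x \<in> C"
  have "finite C" using C(1) assms(1) by (auto intro: finite_subset)
  then have "p ` C = C"
    using C(2) permutes_inj_on[OF pN] by (simp add: endo_inj_surj)
  then have "restrict_id p C permutes C"
    using permutes_inj_on[OF pN] by (intro permutes_restrict_id) (simp add: bij_betw_def)
  then have "restrict_id p C permutes N" by (rule permutes_subset) (use C in blast)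
  then have "restrict_id p C \<in> linkings N R {} t"
    using p C(1) by (auto simp: linkings_def restrict_id_def)
  then have "restrict_id p C = id" using trivial by simp
  then show "p x = x" using C(3) by (auto simp: restrict_id_def fun_eq_iff split: if_splits)
qed (use assms in auto)

definition step_weight :: "('a \<Rightarrow> 'a \<Rightarrow> bool) \<Rightarrow> 'a \<Rightarrow> 'a \<Rightarrow> int" where
  "step_weight R x y = (if x = y then 1 else if R x y then -1 else 0)"

text \<open>In the Leibniz term of a linking, the factors -1 of the moved points outside
  \<open>B\<close> multiply to the sign of the permutation, so the term is 1. Any other permutation
  picks a zero entry.\<close>

lemma card_linkings_eq_set_det:
  assumes "finite N" and "B \<subseteq> N" and "linkings N R {} t = {id}"
    and "\<And>p x y k. p \<in> linkings N R B s \<Longrightarrow> x \<in> B \<Longrightarrow> y \<in> B \<Longrightarrow> (p ^^ k) x = y \<Longrightarrow> x = y"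
  shows "int (card (linkings N R B s)) =
    set_det N (\<lambda>x y. if x \<in> B then of_bool (y = s x) else step_weight R x y)"
proof -
  let ?F = "\<lambda>x y. if x \<in> B then of_bool (y = s x) else step_weight R x y"
  have "of_int (sign p) * (\<Prod>x\<in>N. ?F x (p x)) = of_bool (p \<in> linkings N R B s)"
    if p: "p permutes N" for p
  proof (cases "p \<in> linkings N R B s")
    case True
    have "(\<Prod>x\<in>N. ?F x (p x)) = (\<Prod>x\<in>N - B. if p x \<noteq> x then -1 else 1)"
      using True assms(1,2)
      by (intro prod.mono_neutral_cong_right) (auto simp: linkings_def step_weight_def)
    also have "\<dots> = (\<Prod>x\<in>{x \<in> N - B. p x \<noteq> x}. -1)"
      using assms(1) by (intro prod.inter_filter[symmetric]) simp
    also have "\<dots> = (-1) ^ card {x \<in> N - B. p x \<noteq> x}" by simp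
    also have "\<dots> = sign p"
      using sign_linking[OF assms(1-3) True assms(4)[OF True]] by simp
    finally show ?thesis using True by simp
  next
    case False
    then obtain x where "x \<in> B \<and> p x \<noteq> s x \<or> x \<in> N - B \<and> p x \<noteq> x \<and> \<not> R x (p x)"
      using p by (auto simp: linkings_def)
    then have "\<exists>x\<in>N. ?F x (p x) = 0"
      using assms(2) by (intro bexI[of _ x]) (auto simp: step_weight_def)
    then have "(\<Prod>x\<in>N. ?F x (p x)) = 0" using assms(1) by (intro prod_zero)
    then show ?thesis using False by simp
  qed
  then have "set_det N ?F = (\<Sum>p | p permutes N. of_bool (p \<in> linkings N R B s))"
    unfolding set_det_def by (intro sum.cong) auto
  also have "\<dots> = int (card ({p. p permutes N} \<inter> linkings N R B s))"
    using finite_permutations[OF assms(1)] by simp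
  also have "{p. p permutes N} \<inter> linkings N R B s = linkings N R B s"
    using linkings_permutes by auto
  finally show ?thesis by simp
qed

theorem card_linkings_eq_det_card_linkings:
  assumes "finite N" and "B \<subseteq> N" and "s ` B \<subseteq> N" and trivial: "linkings N R {} t = {id}"
    and once: "\<And>p x y k. p \<in> linkings N R B s \<Longrightarrow> x \<in> B \<Longrightarrow> y \<in> B \<Longrightarrow> (p ^^ k) x = y \<Longrightarrow> x = y"
  shows "int (card (linkings N R B s)) =
    set_det B (\<lambda>x y. int (card (linkings N R {y} (\<lambda>_. s x))))"
proof -
  have one: "set_det N (step_weight R) = 1"
    using card_linkings_eq_set_det[of N "{}" R t t] assms(1) trivial by simp
  then obtain P where P: "\<And>x y. x \<in> N \<Longrightarrow> y \<in> N \<Longrightarrow>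
      (\<Sum>z\<in>N. step_weight R x z * P z y) = of_bool (x = y)"
    using right_inverse_if_set_det_eq_1[OF assms(1)] by metis
  have "set_det N (\<lambda>x y. \<Sum>z\<in>N. step_weight R x z * P z y) = set_det N (\<lambda>x y. of_bool (x = y) :: int)"
    by (rule set_det_cong) (rule P)
  also have "\<dots> = 1"
    using set_det_unit_rows[OF assms(1) empty_subsetI, of "\<lambda>x y. of_bool (x = y) :: int"]
    by (simp add: set_det_def sign_id)
  finally have one_P: "set_det N P = 1"
    by (simp add: set_det_mult[OF assms(1)] one)
  \<comment> \<open>Stated for general \<open>C\<close> and \<open>u\<close> to serve both for all
    of \<open>B\<close> and for single end points, where the condition on powers is trivial.\<close>
  have paths: "int (card (linkings N R C u)) = set_det C (\<lambda>x y. P (u x) y)"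
    if C: "C \<subseteq> N" "u ` C \<subseteq> N" and
      "\<And>p x y k. p \<in> linkings N R C u \<Longrightarrow> x \<in> C \<Longrightarrow> y \<in> C \<Longrightarrow> (p ^^ k) x = y \<Longrightarrow> x = y" for C u
  proof -
    let ?F = "\<lambda>x y. if x \<in> C then of_bool (y = u x) else step_weight R x y"
    have rows: "(\<Sum>z\<in>N. ?F x z * P z y) = (if x \<in> C then P (u x) y else of_bool (x = y))"
      if "x \<in> N" "y \<in> N" for x y
    proof (cases "x \<in> C")
      case True
      then have "u x \<in> N" using C by auto
      have "(\<Sum>z\<in>N. ?F x z * P z y) = (\<Sum>z\<in>N. if z = u x then P z y else 0)"
        using True by (intro sum.cong) auto
      then show ?thesis using True \<open>u x \<in> N\<close> assms(1) by simp
    qed (use P that in simp)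
    have "int (card (linkings N R C u)) = set_det N ?F"
      by (rule card_linkings_eq_set_det[OF assms(1) C(1) trivial that(3)])
    also have "\<dots> = set_det N (\<lambda>x y. \<Sum>z\<in>N. ?F x z * P z y)"
      using one_P by (simp add: set_det_mult[OF assms(1)])
    also have "\<dots> = set_det N (\<lambda>x y. if x \<in> C then P (u x) y else of_bool (x = y))"
      by (rule set_det_cong) (rule rows)
    also have "\<dots> = set_det C (\<lambda>x y. if x \<in> C then P (u x) y else of_bool (x = y))"
      using assms(1) C(1) by (intro set_det_unit_rows) auto
    also have "\<dots> = set_det C (\<lambda>x y. P (u x) y)"
      by (rule set_det_cong) simp
    finally show ?thesis .
  qed
  have entry: "int (card (linkings N R {y} (\<lambda>_. s x))) = P (s x) y" if "x \<in> B" "y \<in> B" for x y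
  proof -
    have "int (card (linkings N R {y} (\<lambda>_. s x))) = set_det {y} (\<lambda>_ y. P (s x) y)"
      by (rule paths) (use that assms(2,3) in auto)
    then show ?thesis by (simp add: set_det_def sign_id)
  qed
  have "int (card (linkings N R B s)) = set_det B (\<lambda>x y. P (s x) y)"
    by (rule paths) (use assms once in auto)
  also have "\<dots> = set_det B (\<lambda>x y. int (card (linkings N R {y} (\<lambda>_. s x))))"
    using entry by (intro set_det_cong) simp
  finally show ?thesis .
qed

section \<open>Matchings of bipartite graphs as linkings\<close>

text \<open>This treats one colour class, with \<open>f\<close> giving the end of an edge in it.
  Since \<open>f\<close> is injective on \<open>\<mu>\<close>, the images of
  \<open>M \<inter> \<mu>\<close> and \<open>\<mu> - M\<close> are disjoint, and the latter cancels
  from the equation of images.\<close>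

lemma inj_on_symm_diff_iff:
  fixes f :: "'e \<Rightarrow> 'v"
  assumes "inj_on f \<mu>" and "A \<inter> f ` \<mu> = {}" and "B \<subseteq> f ` \<mu>"
  shows "inj_on f ((M - \<mu>) \<union> (\<mu> - M)) \<and> f ` ((M - \<mu>) \<union> (\<mu> - M)) = (f ` \<mu> - B) \<union> A \<longleftrightarrow>
    inj_on f (M - \<mu>) \<and> f ` (M - \<mu>) \<inter> B = {} \<and> f ` (M - \<mu>) \<union> B = f ` (M \<inter> \<mu>) \<union> A"
proof -
  have split: "f ` \<mu> = f ` (M \<inter> \<mu>) \<union> f ` (\<mu> - M)" "f ` (M \<inter> \<mu>) \<inter> f ` (\<mu> - M) = {}"
    using assms(1) by (auto simp: inj_on_def)
  have inj: "inj_on f ((M - \<mu>) \<union> (\<mu> - M)) \<longleftrightarrow>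
      inj_on f (M - \<mu>) \<and> f ` (M - \<mu>) \<inter> f ` (\<mu> - M) = {}"
    using inj_on_subset[OF assms(1), of "\<mu> - M"] by (subst inj_on_Un) (auto simp: Diff_Int_distrib)
  have "X \<inter> Z = {} \<and> X \<union> Z = (Y \<union> Z - B) \<union> A \<longleftrightarrow> X \<inter> B = {} \<and> X \<union> B = Y \<union> A"
    if "Y \<inter> Z = {}" "A \<inter> (Y \<union> Z) = {}" "B \<subseteq> Y \<union> Z" for X Y Z :: "'v set"
  proof -
    have "x \<in> Y \<Longrightarrow> x \<notin> Z" "x \<in> A \<Longrightarrow> x \<notin> Y \<and> x \<notin> Z" "x \<in> B \<Longrightarrow> x \<in> Y \<or> x \<in> Z" for x
      using that by blast+
    then show ?thesis unfolding set_eq_iff Un_iff Int_iff Diff_iff empty_iff by smt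
  qed
  from this[of "f ` (M \<inter> \<mu>)" "f ` (\<mu> - M)" "f ` (M - \<mu>)"] show ?thesis
    unfolding inj image_Un using split assms(2,3) by simp
qed

text \<open>Edges are abstract objects with end maps, so parallel edges stay distinct. The last
  assumptions say that \<open>\<mu>\<close> is a perfect matching of the subgraph induced by
  \<open>L\<close>.\<close>

locale matched_bigraph =
  fixes U V L :: "'v set" and E \<mu> :: "'e set" and u v :: "'e \<Rightarrow> 'v"
  assumes finite_vertices: "finite (U \<union> V)" and finite_edges: "finite E"
    and disjoint: "U \<inter> V = {}"
    and u_in: "\<And>e. e \<in> E \<Longrightarrow> u e \<in> U" and v_in: "\<And>e. e \<in> E \<Longrightarrow> v e \<in> V"
    and mu_subset: "\<mu> \<subseteq> E" and inj_u: "inj_on u \<mu>" and inj_v: "inj_on v \<mu>"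
    and u_mu: "u ` \<mu> = L \<inter> U" and v_mu: "v ` \<mu> = L \<inter> V"
begin

section \<open>Symmetric differences with the reference matching\<close>

definition matchings :: "'v set \<Rightarrow> 'e set set" where
  "matchings W =
     {P. P \<subseteq> E \<and> inj_on u P \<and> inj_on v P \<and> u ` P = W \<inter> U \<and> v ` P = W \<inter> V}"

definition tail :: "'e \<Rightarrow> 'v" where
  "tail e = (if e \<in> \<mu> then v e else u e)"

definition head :: "'e \<Rightarrow> 'v" where
  "head e = (if e \<in> \<mu> then u e else v e)"

text \<open>Injectivity bounds the in- and outdegrees by 1. The other conditions say that paths
  start in \<open>A\<close> and end in \<open>B\<close>, and that any other vertex is left exactly
  if it is entered.\<close>

definition path_covers :: "'v set \<Rightarrow> 'v set \<Rightarrow> 'e set set" where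
  "path_covers A B =
     {M. M \<subseteq> E \<and> inj_on tail M \<and> inj_on head M \<and> tail ` M \<inter> B = {} \<and> head ` M \<inter> A = {} \<and>
       tail ` M \<union> B = head ` M \<union> A}"

text \<open>
  Under the assumptions on \<open>A\<close> and \<open>B\<close> made below, this is the symmetric difference of \<open>L\<close> and
  \<open>A \<union> B\<close>.
\<close>

definition exchange :: "'v set \<Rightarrow> 'v set \<Rightarrow> 'v set" where
  "exchange A B = (L - (A \<union> B)) \<union> (A \<inter> U) \<union> (B \<inter> V)"

lemma tail_image: "M \<subseteq> E \<Longrightarrow> tail ` M = u ` (M - \<mu>) \<union> v ` (M \<inter> \<mu>)"
  by (auto simp: tail_def)

lemma head_image: "M \<subseteq> E \<Longrightarrow> head ` M = v ` (M - \<mu>) \<union> u ` (M \<inter> \<mu>)"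
  by (auto simp: head_def)

text \<open>Edges of \<open>\<mu>\<close> have tails in \<open>V\<close>, all others in
  \<open>U\<close>, so tails can collide only within one kind, and within \<open>\<mu>\<close> they
  never do.\<close>

lemma inj_on_tail: "M \<subseteq> E \<Longrightarrow> inj_on tail M \<longleftrightarrow> inj_on u (M - \<mu>)"
proof
  assume M: "M \<subseteq> E" and "inj_on u (M - \<mu>)"
  then show "inj_on tail M"
    using inj_v u_in v_in disjoint mu_subset unfolding inj_on_def tail_def
    by (smt (verit) Diff_iff disjoint_iff subsetD)
qed (auto simp: inj_on_def tail_def)

lemma inj_on_head: "M \<subseteq> E \<Longrightarrow> inj_on head M \<longleftrightarrow> inj_on v (M - \<mu>)"
proof
  assume M: "M \<subseteq> E" and "inj_on v (M - \<mu>)"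
  then show "inj_on head M"
    using inj_u u_in v_in disjoint mu_subset unfolding inj_on_def head_def
    by (smt (verit) Diff_iff disjoint_iff subsetD)
qed (auto simp: inj_on_def head_def)

text \<open>On \<open>U\<close> the exchange adds \<open>A \<inter> U\<close> and removes
  \<open>B \<inter> U\<close>; on \<open>V\<close> the roles of \<open>A\<close> and
  \<open>B\<close> are swapped. The criterion for one colour class applies to each, and the results
  combine to the conditions on a path cover.\<close>

lemma symm_diff_matching_iff:
  assumes AB: "A \<union> B \<subseteq> U \<union> V"
    and "A \<inter> U \<inter> L = {}" "A \<inter> V \<subseteq> L" "B \<inter> U \<subseteq> L" "B \<inter> V \<inter> L = {}" and M: "M \<subseteq> E"
  shows "(M - \<mu>) \<union> (\<mu> - M) \<in> matchings (exchange A B) \<longleftrightarrow> M \<in> path_covers A B"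
proof -
  let ?P = "(M - \<mu>) \<union> (\<mu> - M)"
  have PE: "?P \<subseteq> E" using M mu_subset by auto
  have AU: "A \<inter> U \<inter> u ` \<mu> = {}" and BU: "B \<inter> U \<subseteq> u ` \<mu>"
    and BV: "B \<inter> V \<inter> v ` \<mu> = {}" and AV: "A \<inter> V \<subseteq> v ` \<mu>"
    using assms unfolding u_mu v_mu by auto
  have ex: "exchange A B \<inter> U = (u ` \<mu> - B \<inter> U) \<union> (A \<inter> U)"
    "exchange A B \<inter> V = (v ` \<mu> - A \<inter> V) \<union> (B \<inter> V)"
    unfolding exchange_def u_mu v_mu using disjoint assms by auto
  have M_in: "u ` (M - \<mu>) \<subseteq> U" "u ` (M \<inter> \<mu>) \<subseteq> U" "v ` (M - \<mu>) \<subseteq> V" "v ` (M \<inter> \<mu>) \<subseteq> V"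
    using u_in v_in M by auto
  have "?P \<in> matchings (exchange A B) \<longleftrightarrow>
      (inj_on u (M - \<mu>) \<and> u ` (M - \<mu>) \<inter> (B \<inter> U) = {} \<and>
        u ` (M - \<mu>) \<union> (B \<inter> U) = u ` (M \<inter> \<mu>) \<union> (A \<inter> U)) \<and>
      (inj_on v (M - \<mu>) \<and> v ` (M - \<mu>) \<inter> (A \<inter> V) = {} \<and>
        v ` (M - \<mu>) \<union> (A \<inter> V) = v ` (M \<inter> \<mu>) \<union> (B \<inter> V))"
    unfolding inj_on_symm_diff_iff[OF inj_u AU BU, symmetric]
      inj_on_symm_diff_iff[OF inj_v BV AV, symmetric] matchings_def ex
    using PE by blast
  also have "\<dots> \<longleftrightarrow> M \<in> path_covers A B"
  proof -
    \<comment> \<open>The balance equation splits into its parts in \<open>U\<close> and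
      \<open>V\<close>. Edges of \<open>\<mu>\<close> have both ends in \<open>L\<close>, so their
      tails avoid \<open>B\<close> and their heads avoid \<open>A\<close>.\<close>
    define X Y Z T where XYZT: "X = u ` (M - \<mu>)" "Y = u ` (M \<inter> \<mu>)" "Z = v ` (M - \<mu>)" "T = v ` (M \<inter> \<mu>)"
    have in_UV: "X \<subseteq> U" "Y \<subseteq> U" "Z \<subseteq> V" "T \<subseteq> V" using M_in by (simp_all add: XYZT)
    have "Y \<subseteq> L" "T \<subseteq> L" using u_mu v_mu by (auto simp: XYZT)
    then have TB: "T \<inter> B = {}" and YA: "Y \<inter> A = {}" using in_UV assms by blast+
    have "X \<union> T \<union> B = Z \<union> Y \<union> A \<longleftrightarrow>
        (X \<union> T \<union> B) \<inter> U = (Z \<union> Y \<union> A) \<inter> U \<and> (X \<union> T \<union> B) \<inter> V = (Z \<union> Y \<union> A) \<inter> V"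
      using in_UV AB by blast
    moreover have "(X \<union> T \<union> B) \<inter> U = X \<union> (B \<inter> U)" "(Z \<union> Y \<union> A) \<inter> U = Y \<union> (A \<inter> U)"
      "(X \<union> T \<union> B) \<inter> V = T \<union> (B \<inter> V)" "(Z \<union> Y \<union> A) \<inter> V = Z \<union> (A \<inter> V)"
      using in_UV disjoint by blast+
    moreover have "X \<inter> (B \<inter> U) = {} \<longleftrightarrow> (X \<union> T) \<inter> B = {}" "Z \<inter> (A \<inter> V) = {} \<longleftrightarrow> (Z \<union> Y) \<inter> A = {}"
      using in_UV TB YA by blast+
    ultimately show ?thesis
      unfolding path_covers_def mem_Collect_eq inj_on_tail[OF M] inj_on_head[OF M]
        tail_image[OF M] head_image[OF M] XYZT[symmetric]
      using M by (simp only: simp_thms) metis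
  qed
  finally show ?thesis .
qed

lemma card_matchings_eq_card_path_covers:
  assumes "A \<union> B \<subseteq> U \<union> V"
    and "A \<inter> U \<inter> L = {}" "A \<inter> V \<subseteq> L" "B \<inter> U \<subseteq> L" "B \<inter> V \<inter> L = {}"
  shows "card (matchings (exchange A B)) = card (path_covers A B)"
proof -
  let ?d = "\<lambda>M. (M - \<mu>) \<union> (\<mu> - M)"
  have dd: "?d (?d M) = M" for M by auto
  have "bij_betw ?d (path_covers A B) (matchings (exchange A B))"
  proof (rule bij_betw_byWitness[where f' = ?d])
    show "?d ` path_covers A B \<subseteq> matchings (exchange A B)"
      using symm_diff_matching_iff[OF assms] by (auto simp: path_covers_def)
    show "?d ` matchings (exchange A B) \<subseteq> path_covers A B"
    proof
      fix M assume "M \<in> ?d ` matchings (exchange A B)"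
      then obtain P where P: "P \<in> matchings (exchange A B)" "M = ?d P" by auto
      then have "?d M \<in> matchings (exchange A B)" "M \<subseteq> E"
        using dd[of P] mu_subset by (auto simp: matchings_def)
      then show "M \<in> path_covers A B" using symm_diff_matching_iff[OF assms] by blast
    qed
  qed (use dd in auto)
  then show ?thesis by (rule bij_betw_same_card[symmetric])
qed

section \<open>Path covers as linkings of vertices and edges\<close>

text \<open>
  The edges become nodes as well, so that parallel edges need no multiplicities.
\<close>

definition nodes :: "('v + 'e) set" where
  "nodes = Inl ` (U \<union> V) \<union> Inr ` E"

definition step :: "'v + 'e \<Rightarrow> 'v + 'e \<Rightarrow> bool" where
  "step x y \<longleftrightarrow> (\<exists>e\<in>E. x = Inl (tail e) \<and> y = Inr e \<or> x = Inr e \<and> y = Inl (head e))"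

lemma finite_nodes: "finite nodes"
  using finite_vertices finite_edges by (simp add: nodes_def)

abbreviation links :: "'v set \<Rightarrow> ('v \<Rightarrow> 'v) \<Rightarrow> ('v + 'e \<Rightarrow> 'v + 'e) set" where
  "links B \<sigma> \<equiv> linkings nodes step (Inl ` B) (map_sum \<sigma> id)"

lemma tail_in: "e \<in> E \<Longrightarrow> tail e \<in> U \<union> V" and head_in: "e \<in> E \<Longrightarrow> head e \<in> U \<union> V"
  using u_in v_in by (auto simp: tail_def head_def)

lemma links_source: "p \<in> links B \<sigma> \<Longrightarrow> b \<in> B \<Longrightarrow> p (Inl b) = Inl (\<sigma> b)"
  by (auto simp: linkings_def)

lemma links_edge:
  assumes "p \<in> links B \<sigma>" "e \<in> E"
  shows "p (Inr e) = Inr e \<or> p (Inr e) = Inl (head e)"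
  using assms by (auto simp: linkings_def nodes_def step_def)

lemma links_vertex:
  assumes "p \<in> links B \<sigma>" "x \<in> U \<union> V" "x \<notin> B"
  shows "p (Inl x) = Inl x \<or> (\<exists>e\<in>E. x = tail e \<and> p (Inl x) = Inr e)"
  using assms by (fastforce simp: linkings_def nodes_def step_def)

text \<open>Only an edge itself and its tail can be mapped to the edge. As \<open>p\<close> is a
  bijection, a moved edge is reached from its tail, and a fixed one is not.\<close>

lemma links_edge_moved_iff:
  assumes p: "p \<in> links B \<sigma>" and "e \<in> E"
  shows "p (Inr e) \<noteq> Inr e \<longleftrightarrow> tail e \<notin> B \<and> p (Inl (tail e)) = Inr e"
proof
  note pN = linkings_permutes[OF p]
  assume moved: "p (Inr e) \<noteq> Inr e"
  have "Inr e \<in> nodes" using assms by (simp add: nodes_def)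
  then obtain y where y: "y \<in> nodes" "p y = Inr e"
    using permutes_image[OF pN] by (metis imageE)
  show "tail e \<notin> B \<and> p (Inl (tail e)) = Inr e"
  proof (cases y)
    case (Inl x)
    then have x: "x \<in> U \<union> V" using y by (auto simp: nodes_def)
    have "x \<notin> B" using links_source[OF p] y Inl by auto
    then show ?thesis using links_vertex[OF p x] y Inl by auto
  next
    case (Inr f)
    then have "f \<in> E" using y by (auto simp: nodes_def)
    then show ?thesis using links_edge[OF p, of f] y moved Inr by auto
  qed
next
  assume "tail e \<notin> B \<and> p (Inl (tail e)) = Inr e"
  then show "p (Inr e) \<noteq> Inr e"
    using inj_eq[OF permutes_inj[OF linkings_permutes[OF p]], of "Inr e" "Inl (tail e)"] by auto
qed

definition moved :: "('v + 'e \<Rightarrow> 'v + 'e) \<Rightarrow> 'e set" where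
  "moved p = {e \<in> E. p (Inr e) \<noteq> Inr e}"

text \<open>The inverse of \<open>moved\<close>: a used edge is entered from its tail and left to
  its head, and \<open>\<sigma>\<close> closes up the paths.\<close>

definition flow :: "'v set \<Rightarrow> ('v \<Rightarrow> 'v) \<Rightarrow> 'e set \<Rightarrow> 'v + 'e \<Rightarrow> 'v + 'e" where
  "flow B \<sigma> M z = (case z of
      Inl x \<Rightarrow> if x \<in> B then Inl (\<sigma> x) else if x \<in> tail ` M then Inr (the_inv_into M tail x) else Inl x
    | Inr e \<Rightarrow> if e \<in> M then Inl (head e) else Inr e)"

lemma moved_head: "p \<in> links B \<sigma> \<Longrightarrow> e \<in> moved p \<Longrightarrow> p (Inr e) = Inl (head e)"
  using links_edge by (fastforce simp: moved_def)

lemma moved_tail: "p \<in> links B \<sigma> \<Longrightarrow> e \<in> moved p \<Longrightarrow> tail e \<notin> B \<and> p (Inl (tail e)) = Inr e"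
  using links_edge_moved_iff by (force simp: moved_def)

lemma moved_path_cover:
  assumes p: "p \<in> links B \<sigma>" and B: "B \<subseteq> U \<union> V" and \<sigma>: "bij_betw \<sigma> B A" and A: "A \<subseteq> U \<union> V"
  shows "moved p \<in> path_covers A B"
proof -
  note pN = linkings_permutes[OF p]
  note p_eq = inj_eq[OF permutes_inj[OF pN]]
  have "inj_on tail (moved p)"
    using moved_tail[OF p] by (metis inj_onI sum.inject(2))
  moreover have "inj_on head (moved p)"
    using moved_head[OF p] p_eq by (metis inj_onI sum.inject(2))
  moreover have "tail ` moved p \<inter> B = {}" using moved_tail[OF p] by auto
  moreover have "head ` moved p \<inter> A = {}"
  proof -
    have "head e \<noteq> \<sigma> b" if "e \<in> moved p" "b \<in> B" for e b
      using moved_head[OF p that(1)] links_source[OF p that(2)] p_eq[of "Inr e" "Inl b"] by auto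
    then show ?thesis using \<sigma> by (auto simp: bij_betw_def)
  qed
  moreover have "tail ` moved p \<union> B = head ` moved p \<union> A"
  proof -
    \<comment> \<open>Both sides of the balance consist of the moved vertices and
      \<open>A \<inter> B\<close>, whose points need not move since \<open>\<sigma>\<close> may fix
      them.\<close>
    have "x \<in> tail ` moved p \<union> B \<longleftrightarrow> p (Inl x) \<noteq> Inl x \<or> x \<in> A \<inter> B" if x: "x \<in> U \<union> V" for x
    proof (cases "x \<in> B")
      case True
      then show ?thesis
        using links_source[OF p True] \<sigma> by (force simp: bij_betw_def)
    next
      case False
      have "p (Inl x) \<noteq> Inl x" if "x \<in> tail ` moved p"
        using that moved_tail[OF p] by fastforce
      moreover have "x \<in> tail ` moved p" if ne: "p (Inl x) \<noteq> Inl x"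
      proof -
        obtain e where e: "e \<in> E" "x = tail e" "p (Inl x) = Inr e"
          using links_vertex[OF p x False] ne by blast
        then have "e \<in> moved p" using links_edge_moved_iff[OF p e(1)] False by (simp add: moved_def)
        then show ?thesis using e by blast
      qed
      ultimately show ?thesis using False by blast
    qed
    moreover have "x \<in> head ` moved p \<union> A \<longleftrightarrow> p (Inl x) \<noteq> Inl x \<or> x \<in> A \<inter> B"
      if x: "x \<in> U \<union> V" for x
    proof -
      have "Inl x \<in> nodes" using x by (auto simp: nodes_def)
      \<comment> \<open>The preimage of \<open>x\<close> decides: an edge has head \<open>x\<close>,
        a vertex in \<open>B\<close> is an end point with start \<open>x\<close>, and any other
        vertex is \<open>x\<close> itself.\<close>
      then obtain y where y: "y \<in> nodes" "p y = Inl x"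
        using permutes_image[OF pN] by (metis imageE)
      show ?thesis
      proof (cases y)
        case (Inr e)
        then have "e \<in> moved p" using y by (auto simp: nodes_def moved_def)
        then have "x \<in> head ` moved p" using moved_head[OF p] y Inr by force
        moreover have "p (Inl x) \<noteq> Inl x" using p_eq[of "Inl x" y] y Inr by auto
        ultimately show ?thesis by auto
      next
        case (Inl w)
        have no_head: "x \<notin> head ` moved p"
        proof
          assume "x \<in> head ` moved p"
          then obtain e where "e \<in> moved p" "x = head e" by blast
          then have "p (Inr e) = p y" using moved_head[OF p] y by simp
          then show False using p_eq Inl by blast
        qed
        have w: "w \<in> U \<union> V" using y Inl by (auto simp: nodes_def)
        show ?thesis
        proof (cases "w \<in> B")
          case True
          then have "x = \<sigma> w" using links_source[OF p True] y Inl by auto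
          then have "x \<in> A" using \<sigma> True by (auto simp: bij_betw_def)
          moreover have "p (Inl x) = Inl x \<Longrightarrow> x \<in> B" using p_eq[of "Inl x" y] y Inl True by auto
          ultimately show ?thesis by auto
        next
          case False
          then have "p (Inl x) = Inl x" using links_vertex[OF p w False] y Inl by auto
          moreover have "x \<notin> A"
          proof
            assume "x \<in> A"
            then obtain b where "b \<in> B" "x = \<sigma> b" using \<sigma> by (auto simp: bij_betw_def)
            then show False using links_source[OF p, of b] y Inl p_eq[of y "Inl b"] False by auto
          qed
          ultimately show ?thesis using no_head by auto
        qed
      qed
    qed
    moreover have "tail ` moved p \<union> B \<subseteq> U \<union> V" "head ` moved p \<union> A \<subseteq> U \<union> V"
      using tail_in head_in A B by (auto simp: moved_def)
    ultimately show ?thesis by blast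
  qed
  ultimately show ?thesis by (auto simp: path_covers_def moved_def)
qed

lemma flow_moved:
  assumes p: "p \<in> links B \<sigma>"
  shows "flow B \<sigma> (moved p) = p"
proof
  fix z
  have inj: "inj_on tail (moved p)"
    using moved_tail[OF p] by (metis inj_onI sum.inject(2))
  show "flow B \<sigma> (moved p) z = p z"
  proof (cases z)
    case (Inr e)
    have "p (Inr e) = Inr e" if "e \<notin> E"
      using permutes_not_in[OF linkings_permutes[OF p]] that by (auto simp: nodes_def)
    then show ?thesis using moved_head[OF p, of e] Inr by (auto simp: flow_def moved_def)
  next
    case (Inl x)
    consider "x \<in> B" | "x \<notin> B" "x \<in> tail ` moved p" | "x \<notin> B" "x \<notin> tail ` moved p" by blast
    then show ?thesis
    proof cases
      case 1
      then show ?thesis using links_source[OF p] Inl by (auto simp: flow_def)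
    next
      case 2
      then obtain e where e: "e \<in> moved p" "x = tail e" by blast
      have "p z = Inr e" using moved_tail[OF p e(1)] e(2) Inl by simp
      then show ?thesis using 2 e Inl the_inv_into_f_f[OF inj e(1)] by (simp add: flow_def)
    next
      case 3
      have "p (Inl x) = Inl x"
      proof (cases "x \<in> U \<union> V")
        case True
        have False if "e \<in> E" "x = tail e" "p (Inl x) = Inr e" for e
          using 3 that links_edge_moved_iff[OF p that(1)] by (auto simp: moved_def)
        then show ?thesis using links_vertex[OF p True 3(1)] by blast
      next
        case False
        then show ?thesis
          using permutes_not_in[OF linkings_permutes[OF p]] by (auto simp: nodes_def)
      qed
      then show ?thesis using 3 Inl by (auto simp: flow_def)
    qed
  qed
qed

lemma flow_link:
  assumes M: "M \<in> path_covers A B" and B: "B \<subseteq> U \<union> V" and \<sigma>: "bij_betw \<sigma> B A" and A: "A \<subseteq> U \<union> V"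
  shows "flow B \<sigma> M \<in> links B \<sigma>" and "moved (flow B \<sigma> M) = M"
proof -
  have ME: "M \<subseteq> E" and inj: "inj_on tail M" "inj_on head M"
    and disj: "tail ` M \<inter> B = {}" "head ` M \<inter> A = {}"
    and eq: "tail ` M \<union> B = head ` M \<union> A"
    using M by (auto simp: path_covers_def)
  have \<sigma>B: "\<sigma> ` B = A" "inj_on \<sigma> B" using \<sigma> by (auto simp: bij_betw_def)
  have fB: "flow B \<sigma> M (Inl b) = Inl (\<sigma> b)" if "b \<in> B" for b using that by (simp add: flow_def)
  have ft: "flow B \<sigma> M (Inl (tail e)) = Inr e" if "e \<in> M" for e
    using that disj inj by (auto simp: flow_def the_inv_into_f_f)
  have fx: "flow B \<sigma> M (Inl x) = Inl x" if "x \<notin> B" "x \<notin> tail ` M" for x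
    using that by (simp add: flow_def)
  have fe: "flow B \<sigma> M (Inr e) = (if e \<in> M then Inl (head e) else Inr e)" for e
    by (simp add: flow_def)
  have surj: "z \<in> flow B \<sigma> M ` nodes" if z: "z \<in> nodes" for z
  proof (cases z)
    case (Inr e)
    then have "e \<in> E" using z by (auto simp: nodes_def)
    then have "Inr e \<in> nodes" "Inl (tail e) \<in> nodes" using tail_in by (auto simp: nodes_def)
    then show ?thesis using ft[of e] fe[of e] Inr by (cases "e \<in> M") (metis imageI)+
  next
    case (Inl x)
    then have x: "x \<in> U \<union> V" using z by (auto simp: nodes_def)
    \<comment> \<open>By the balance equation, a vertex that is neither a start nor a head is
      neither an end point nor a tail, so it is fixed.\<close>
    consider b where "b \<in> B" "x = \<sigma> b" | e where "e \<in> M" "x = head e" | "x \<notin> B" "x \<notin> tail ` M"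
      using eq \<sigma>B by blast
    then show ?thesis
    proof cases
      case 1
      then have "Inl b \<in> nodes" using B by (auto simp: nodes_def)
      then show ?thesis using fB[OF 1(1)] 1(2) Inl by (metis imageI)
    next
      case 2
      then have "Inr e \<in> nodes" using ME by (auto simp: nodes_def)
      then show ?thesis using fe[of e] 2 Inl by (metis imageI)
    next
      case 3
      then show ?thesis using fx z Inl by (metis imageI)
    qed
  qed
  have "flow B \<sigma> M ` nodes \<subseteq> nodes"
  proof
    fix z assume "z \<in> flow B \<sigma> M ` nodes"
    then obtain y where y: "y \<in> nodes" "z = flow B \<sigma> M y" by blast
    show "z \<in> nodes"
    proof (cases y)
      case (Inr e)
      then show ?thesis using y fe head_in ME by (auto simp: nodes_def)
    next
      case (Inl x)
      consider "x \<in> B" | e where "e \<in> M" "x = tail e" | "x \<notin> B" "x \<notin> tail ` M" by blast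
      then show ?thesis
        using y Inl fB ft fx \<sigma>B A ME by cases (auto simp: nodes_def)
    qed
  qed
  then have "flow B \<sigma> M ` nodes = nodes" using surj by blast
  then have "bij_betw (flow B \<sigma> M) nodes nodes"
    using finite_nodes by (simp add: bij_betw_def eq_card_imp_inj_on)
  moreover have "flow B \<sigma> M z = z" if "z \<notin> nodes" for z
    using that B ME tail_in by (cases z) (auto simp: nodes_def flow_def)
  ultimately have "flow B \<sigma> M permutes nodes" by (rule bij_imp_permutes)
  moreover have "flow B \<sigma> M x = x \<or> step x (flow B \<sigma> M x)" if "x \<in> nodes - Inl ` B" for x
  proof (cases x)
    case (Inr e)
    then show ?thesis using fe ME by (auto simp: step_def)
  next
    case (Inl y)
    then have "y \<notin> B" using that by auto
    then show ?thesis using Inl fx ft ME by (cases "y \<in> tail ` M") (auto simp: step_def)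
  qed
  ultimately show "flow B \<sigma> M \<in> links B \<sigma>" using fB by (auto simp: linkings_def)
  show "moved (flow B \<sigma> M) = M" using fe ME by (auto simp: moved_def)
qed

lemma card_matchings_eq_card_links:
  assumes AB: "A \<union> B \<subseteq> U \<union> V"
    and "A \<inter> U \<inter> L = {}" "A \<inter> V \<subseteq> L" "B \<inter> U \<subseteq> L" "B \<inter> V \<inter> L = {}" and \<sigma>: "bij_betw \<sigma> B A"
  shows "card (matchings (exchange A B)) = card (links B \<sigma>)"
proof -
  have "bij_betw moved (links B \<sigma>) (path_covers A B)"
  proof (rule bij_betw_byWitness[where f' = "flow B \<sigma>"])
    show "\<forall>p\<in>links B \<sigma>. flow B \<sigma> (moved p) = p" using flow_moved by blast
    show "\<forall>M\<in>path_covers A B. moved (flow B \<sigma> M) = M" using flow_link(2) AB \<sigma> by blast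
    show "moved ` links B \<sigma> \<subseteq> path_covers A B" using moved_path_cover AB \<sigma> by blast
    show "flow B \<sigma> ` path_covers A B \<subseteq> links B \<sigma>" using flow_link(1) AB \<sigma> by blast
  qed
  then show ?thesis
    using card_matchings_eq_card_path_covers[OF assms(1-5)] by (simp add: bij_betw_same_card)
qed

end

section \<open>Crossing connected sets outside a disc\<close>

lemma sin_two_mult_sum:
  fixes x y :: real
  shows "sin (2 * x) + sin (2 * y) - sin (2 * x + 2 * y) = 4 * sin x * sin y * sin (x + y)"
proof -
  have *: "(cos x)\<^sup>2 = 1 - (sin x)\<^sup>2" "(cos y)\<^sup>2 = 1 - (sin y)\<^sup>2"
    by (simp_all add: cos_squared_eq)
  have "sin (2 * x) + sin (2 * y) - sin (2 * x + 2 * y) =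
      2 * sin x * cos x + 2 * sin y * cos y
        - (2 * sin x * cos x * ((cos y)\<^sup>2 - (sin y)\<^sup>2) + ((cos x)\<^sup>2 - (sin x)\<^sup>2) * (2 * sin y * cos y))"
    by (simp add: sin_add sin_double cos_double)
  also have "\<dots> = 4 * sin x * sin y * sin (x + y)"
    unfolding * sin_add by (simp add: algebra_simps power2_eq_square)
  finally show ?thesis .
qed

text \<open>The vector \<open>\<i> * (cis b - cis a)\<close> is normal to the chord, so the sign of
  this expression tells on which side \<open>cis t\<close> lies; the product form makes that sign
  readable.\<close>

lemma inner_cis_chord:
  fixes a b t :: real
  shows "(\<i> * (cis b - cis a)) \<bullet> cis t - (\<i> * (cis b - cis a)) \<bullet> cis a =
    4 * sin ((t - b) / 2) * sin ((b - a) / 2) * sin ((t - a) / 2)"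
proof -
  have "(\<i> * (cis b - cis a)) \<bullet> cis t - (\<i> * (cis b - cis a)) \<bullet> cis a =
      sin (t - b) + sin (b - a) - sin (t - a)"
    by (simp add: inner_complex_def sin_diff algebra_simps)
  also have "\<dots> = 4 * sin ((t - b) / 2) * sin ((b - a) / 2) * sin ((t - a) / 2)"
  proof -
    have eqs: "2 * ((t - b) / 2) = t - b" "2 * ((b - a) / 2) = b - a" "t - b + (b - a) = t - a"
      "(t - b) / 2 + (b - a) / 2 = (t - a) / 2"
      by (simp_all add: field_simps)
    from sin_two_mult_sum[of "(t - b) / 2" "(b - a) / 2"] show ?thesis unfolding eqs .
  qed
  finally show ?thesis .
qed

text \<open>For \<open>z = p + k (r - p)\<close> one has
  \<open>|z|^2 - 1 = (k^2 - k) |r - p|^2\<close>, which is at most 0 only for \<open>k\<close>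
  between 0 and 1.\<close>

lemma in_chord_if_collinear:
  fixes p r z :: complex
  assumes "norm p = 1" "norm r = 1" "p \<noteq> r" "norm z \<le> 1"
    and "(\<i> * (r - p)) \<bullet> z = (\<i> * (r - p)) \<bullet> p"
  shows "z \<in> closed_segment p r"
proof -
  define k where "k = Re ((z - p) / (r - p))"
  have "Im ((z - p) / (r - p)) = 0"
    using assms(5) by (simp add: Im_divide inner_complex_def algebra_simps)
  then have "(z - p) / (r - p) = of_real k" by (simp add: k_def complex_eq_iff)
  then have z: "z = p + k *\<^sub>R (r - p)"
    using assms(3) by (simp add: field_simps scaleR_conv_of_real)
  have pp: "p \<bullet> p = 1" "r \<bullet> r = 1" using assms(1,2) by (simp_all add: norm_eq_1)
  then have pd: "2 * (p \<bullet> (r - p)) = - ((r - p) \<bullet> (r - p))"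
    by (simp add: inner_diff inner_commute)
  have "z \<bullet> z \<le> 1" using assms(4) by (simp add: norm_le_square power2_norm_eq_inner norm_le)
  moreover have "z \<bullet> z = 1 + k * (2 * (p \<bullet> (r - p))) + k * k * ((r - p) \<bullet> (r - p))"
    unfolding z inner_add inner_scaleR_left inner_scaleR_right pp inner_commute[of "r - p" p]
    by (simp add: algebra_simps)
  ultimately have "(k * k - k) * ((r - p) \<bullet> (r - p)) \<le> 0"
    unfolding pd by (simp add: algebra_simps)
  moreover have "(r - p) \<bullet> (r - p) > 0" using assms(3) by simp
  ultimately have "k * k - k \<le> 0" by (simp only: mult_le_0_iff) linarith
  then have "k * (k - 1) \<le> 0" by (simp add: algebra_simps)
  then have "0 \<le> k" "k \<le> 1" by (auto simp: mult_le_0_iff)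
  then show ?thesis
    unfolding in_segment z by (intro exI[of _ k]) (simp add: algebra_simps)
qed

text \<open>An arc in \<open>S\<close> and the image of a chord of the disc form a Jordan curve. The
  chord separates the two end points of \<open>T\<close> within the disc, so the curve separates
  them in the plane, and \<open>T\<close> has to meet it outside the image of the chord.\<close>

lemma disc_crossing:
  fixes h :: "complex \<Rightarrow> complex" and t1 t2 t3 t4 :: real
  assumes cont: "continuous_on (cball 0 1) h" and inj: "inj_on h (cball 0 1)"
    and t: "0 \<le> t1" "t1 < t2" "t2 < t3" "t3 < t4" "t4 < 2 * pi"
    and S: "path_connected S" "h (cis t1) \<in> S" "h (cis t3) \<in> S"
      "S \<inter> h ` cball 0 1 \<subseteq> {h (cis t1), h (cis t3)}"
    and T: "connected T" "h (cis t2) \<in> T" "h (cis t4) \<in> T"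
      "T \<inter> h ` cball 0 1 \<subseteq> {h (cis t2), h (cis t4)}"
  shows "S \<inter> T \<noteq> {}"
proof
  assume disj: "S \<inter> T = {}"
  define p q r s where "p = cis t1" and "q = cis t2" and "r = cis t3" and "s = cis t4"
  note pqrs = this
  \<comment> \<open>A normal of the chord from \<open>p\<close> to \<open>r\<close>: comparing
    \<open>w \<bullet> z\<close> with \<open>w \<bullet> p\<close> decides the side of
    \<open>z\<close>.\<close>
  define w where "w = \<i> * (r - p)"
  have norm: "norm p = 1" "norm q = 1" "norm r = 1" "norm s = 1" by (simp_all add: pqrs)
  then have in_disc: "p \<in> cball 0 1" "q \<in> cball 0 1" "r \<in> cball 0 1" "s \<in> cball 0 1" by auto
  have sin_pos: "sin ((t3 - t1) / 2) > 0" "sin ((t2 - t1) / 2) > 0" "sin ((t4 - t1) / 2) > 0"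
      "sin ((t4 - t3) / 2) > 0" "sin ((t3 - t2) / 2) > 0"
    using t by (auto intro!: sin_gt_zero)
  then have "sin ((t2 - t3) / 2) < 0"
    using sin_minus[of "(t3 - t2) / 2"] by (simp add: minus_divide_left)
  then have "w \<bullet> q - w \<bullet> p < 0" and "w \<bullet> s - w \<bullet> p > 0"
    unfolding w_def pqrs inner_cis_chord using sin_pos
    by (simp_all add: mult_less_0_iff zero_less_mult_iff)
  then have q: "w \<bullet> q < w \<bullet> p" and s: "w \<bullet> s > w \<bullet> p" by simp_all
  have wr: "w \<bullet> r = w \<bullet> p" by (simp add: w_def inner_complex_def algebra_simps)
  have "p \<noteq> r"
    using q wr inner_cis_chord[of t1 t3 t2] by (auto simp: w_def)
  have seg_disc: "closed_segment p r \<subseteq> cball 0 1"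
    using in_disc by (intro closed_segment_subset) auto
  have w_seg: "w \<bullet> z = w \<bullet> p" if "z \<in> closed_segment p r" for z
  proof -
    obtain k where z: "z = (1 - k) *\<^sub>R p + k *\<^sub>R r"
      using \<open>z \<in> closed_segment p r\<close> by (auto simp: in_segment)
    show ?thesis unfolding z inner_add_right inner_scaleR_right wr by (simp add: algebra_simps)
  qed
  have "h p \<noteq> h r" using inj in_disc \<open>p \<noteq> r\<close> by (auto dest: inj_onD)
  then obtain g where g: "arc g" "path_image g \<subseteq> S" "pathstart g = h p" "pathfinish g = h r"
    using S unfolding path_connected_arcwise pqrs by metis
  define g' where "g' = h \<circ> linepath r p"
  have g'_image: "path_image g' = h ` closed_segment p r"
    by (simp add: g'_def path_image_compose closed_segment_commute)
  have "path g'"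
    unfolding g'_def using cont seg_disc
    by (intro path_continuous_image) (auto simp: closed_segment_commute intro: continuous_on_subset)
  moreover have "inj_on g' {0..1}"
    unfolding g'_def
  proof (rule comp_inj_on)
    show "inj_on (linepath r p) {0..1}" using arc_linepath[of r p] \<open>p \<noteq> r\<close> by (auto simp: arc_def)
    show "inj_on h (linepath r p ` {0..1})"
      using inj_on_subset[OF inj seg_disc] path_image_linepath[of r p]
      by (simp add: path_image_def closed_segment_commute)
  qed
  ultimately have "arc g'" by (simp add: arc_def)
  have ends: "pathstart g' = h r" "pathfinish g' = h p"
    by (simp_all add: g'_def pathstart_compose pathfinish_compose)
  define c where "c = g +++ g'"
  have "path_image g \<inter> path_image g' \<subseteq> {h p, h r}"
    using g(2) g'_image seg_disc S(4) unfolding pqrs by blast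
  then have "simple_path c"
    unfolding c_def using g \<open>arc g'\<close> ends by (intro simple_path_join_loop) auto
  moreover have "pathfinish c = pathstart c" using g ends by (simp add: c_def)
  moreover define C where "C = path_image c"
  ultimately have jordan: "open (inside C)" "open (outside C)"
    "inside C \<inter> outside C = {}" "inside C \<union> outside C = - C"
    "frontier (inside C) = C" "frontier (outside C) = C"
    using Jordan_inside_outside[of c] by auto
  have C: "C = path_image g \<union> h ` closed_segment p r"
    unfolding C_def c_def using g ends g'_image by (simp add: path_image_join)
  have off_C: "h z \<notin> C" if "z \<in> cball 0 1" "w \<bullet> z \<noteq> w \<bullet> p" for z
  proof
    assume "h z \<in> C"
    moreover have "h z \<notin> h ` closed_segment p r"
      using that w_seg seg_disc inj by (metis image_iff inj_onD subsetD)
    ultimately have "h z \<in> S \<inter> h ` cball 0 1" using that C g(2) by blast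
    then have "h z = h p \<or> h z = h r" using S(4) by (auto simp: pqrs)
    then have "z = p \<or> z = r" using inj that in_disc by (auto dest: inj_onD)
    then show False using that wr by auto
  qed
  have one_side: "h ` K \<subseteq> inside C \<or> h ` K \<subseteq> outside C"
    if K: "convex K" "K \<subseteq> cball 0 1" "\<And>z. z \<in> K \<Longrightarrow> w \<bullet> z \<noteq> w \<bullet> p" for K
  proof -
    have "connected (h ` K)"
      using K cont by (intro connected_continuous_image convex_connected) (auto intro: continuous_on_subset)
    moreover have "h ` K \<subseteq> inside C \<union> outside C" using off_C K jordan(4) by blast
    ultimately show ?thesis
      using jordan(1-3) connectedD[of "h ` K" "inside C" "outside C"] by blast
  qed
  \<comment> \<open>The two half discs cut off by the chord lie on different sides of the closed curve
    \<open>C\<close>, since both sides of \<open>C\<close> accumulate at the midpoint of the chord.\<close>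
  define D1 where "D1 = cball 0 1 \<inter> {z. w \<bullet> z < w \<bullet> p}"
  define D2 where "D2 = cball 0 1 \<inter> {z. w \<bullet> z > w \<bullet> p}"
  have D1: "h ` D1 \<subseteq> inside C \<or> h ` D1 \<subseteq> outside C"
    by (rule one_side) (auto simp: D1_def intro!: convex_Int convex_halfspace_lt)
  have D2: "h ` D2 \<subseteq> inside C \<or> h ` D2 \<subseteq> outside C"
    by (rule one_side) (auto simp: D2_def intro!: convex_Int convex_halfspace_gt)
  define m where "m = midpoint p r"
  have m_seg: "m \<in> closed_segment p r" by (simp add: m_def)
  have "m \<in> ball 0 1"
  proof -
    have "(norm (p + r))\<^sup>2 + (norm (p - r))\<^sup>2 = 4"
      using norm by (simp add: power2_norm_eq_inner inner_add inner_diff norm_eq_1 inner_commute)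
    moreover have "(norm (p - r))\<^sup>2 > 0" using \<open>p \<noteq> r\<close> by simp
    ultimately have "(norm (p + r))\<^sup>2 < 4" by linarith
    then have "(norm (p + r))\<^sup>2 < 2\<^sup>2" by simp
    then have "norm (p + r) < 2" by (rule power_less_imp_less_base) simp
    then show ?thesis by (simp add: m_def midpoint_def)
  qed
  \<comment> \<open>By invariance of domain the image of the open disc is a neighbourhood of
    \<open>h m\<close>, a point of \<open>C\<close>, so it meets every set with frontier
    \<open>C\<close>.\<close>
  have "open (h ` ball 0 1)"
    by (rule invariance_of_domain)
      (auto intro: continuous_on_subset[OF cont] inj_on_subset[OF inj])
  moreover have "h m \<in> h ` ball 0 1 \<inter> C" using \<open>m \<in> ball 0 1\<close> m_seg C by blast
  ultimately have meets: "h ` ball 0 1 \<inter> X \<noteq> {}" if "frontier X = C" for X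
    using that open_Int_closure_eq_empty[of "h ` ball 0 1" X] by (auto simp: frontier_def)
  have ball_cover: "h ` ball 0 1 \<subseteq> h ` D1 \<union> h ` D2 \<union> C"
  proof -
    have "z \<in> D1 \<union> D2 \<union> closed_segment p r" if "z \<in> ball 0 1" for z
      using that in_chord_if_collinear[OF norm(1,3) \<open>p \<noteq> r\<close>, of z] unfolding D1_def D2_def w_def
      by (auto simp: not_less_iff_gr_or_eq)
    then show ?thesis using C by blast
  qed
  have opposite: "\<not> (h ` D1 \<subseteq> X \<and> h ` D2 \<subseteq> X)"
    if Y: "frontier Y = C" and XY: "X \<inter> Y = {}" "Y \<subseteq> - C" for X Y
  proof
    assume "h ` D1 \<subseteq> X \<and> h ` D2 \<subseteq> X"
    then have "h ` ball 0 1 \<subseteq> X \<union> C"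
      using ball_cover by (meson Un_mono le_sup_iff order_trans subset_refl)
    moreover obtain y where "y \<in> h ` ball 0 1" "y \<in> Y"
      using meets[OF Y] by (metis Int_iff ex_in_conv)
    ultimately have "y \<in> X \<union> C" "y \<in> Y" by (simp_all only: subsetD)
    then show False using XY by blast
  qed
  have in_out: "inside C \<subseteq> - C" "outside C \<subseteq> - C" "outside C \<inter> inside C = {}"
    using jordan(3,4) by blast+
  have "h q \<in> h ` D1" "h s \<in> h ` D2" using q s in_disc by (auto simp: D1_def D2_def)
  then have "h q \<in> inside C \<and> h s \<in> outside C \<or> h q \<in> outside C \<and> h s \<in> inside C"
    using D1 D2 opposite[OF jordan(6,3) in_out(2)] opposite[OF jordan(5) in_out(3,1)]
    by (metis subsetD)
  then have sep: "inside C \<inter> T \<noteq> {}" "outside C \<inter> T \<noteq> {}"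
    using T(2,3) unfolding pqrs by (metis IntI empty_iff)+
  \<comment> \<open>The arc lies in \<open>S\<close>, which is disjoint from \<open>T\<close>;
    within the image of the disc \<open>T\<close> has only the points \<open>h q\<close> and
    \<open>h s\<close>, which are off \<open>C\<close>.\<close>
  have "T \<inter> C = {}"
  proof -
    have "z \<notin> h ` closed_segment p r" if "z \<in> T" for z
    proof
      assume z: "z \<in> h ` closed_segment p r"
      then have "z = h q \<or> z = h s" using that T(4) seg_disc unfolding pqrs by blast
      then have "z \<notin> C" using off_C[of q] off_C[of s] q s in_disc by auto
      then show False using z C by blast
    qed
    then show ?thesis using C g(2) disj by blast
  qed
  then have "T \<subseteq> inside C \<union> outside C" using jordan(4) by blast
  then show False
    using connectedD[OF T(1) jordan(1,2)] sep jordan(3) by blast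
qed

section \<open>Linkings in plane graphs\<close>

lemma delete_vertices_induced:
  "delete_vertices (induced_subgraph G W) S = induced_subgraph G (vertices G \<inter> W - S)"
  by (auto simp: delete_vertices_def induced_subgraph_def)

lemma delete_vertices_eq_induced: "delete_vertices G S = induced_subgraph G (vertices G - S)"
  by (simp add: delete_vertices_def)

lemma vertices_induced_subgraph: "vertices (induced_subgraph G W) = vertices G \<inter> W"
  by (simp add: induced_subgraph_def)

text \<open>A vertex of \<open>U\<close> lies on an edge exactly if it is its \<open>u\<close>-end,
  and likewise for \<open>V\<close>. So unique coverage of each class turns into injectivity and an
  image condition.\<close>

lemma perfect_matching_induced_iff:
  assumes UV: "U \<union> V = vertices G" "U \<inter> V = {}"
    and ends: "\<And>e. e \<in> edges G \<Longrightarrow> u e \<in> U \<and> v e \<in> V \<and> e \<inter> vertices G = {u e, v e}"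
  shows "perfect_matching (induced_subgraph G W) P \<longleftrightarrow>
    P \<subseteq> edges G \<and> inj_on u P \<and> inj_on v P \<and> u ` P = W \<inter> U \<and> v ` P = W \<inter> V"
proof -
  have in_edge: "x \<in> U \<Longrightarrow> x \<in> e \<longleftrightarrow> x = u e" "x \<in> V \<Longrightarrow> x \<in> e \<longleftrightarrow> x = v e"
    if "e \<in> edges G" for x e
  proof -
    have "x \<in> e \<longleftrightarrow> x \<in> {u e, v e}" if "x \<in> vertices G"
      using ends[OF \<open>e \<in> edges G\<close>] that by (metis IntE IntI)
    moreover have "u e \<in> U" "v e \<in> V" using ends[OF that] by auto
    ultimately show "x \<in> U \<Longrightarrow> x \<in> e \<longleftrightarrow> x = u e" "x \<in> V \<Longrightarrow> x \<in> e \<longleftrightarrow> x = v e"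
      using UV by auto
  qed
  have "perfect_matching (induced_subgraph G W) P \<longleftrightarrow>
      P \<subseteq> edges G \<and> (\<forall>e\<in>P. u e \<in> W \<and> v e \<in> W) \<and>
      (\<forall>x\<in>W \<inter> U. \<exists>!e. e \<in> P \<and> x \<in> e) \<and> (\<forall>x\<in>W \<inter> V. \<exists>!e. e \<in> P \<and> x \<in> e)"
  proof -
    have "e \<inter> vertices G \<subseteq> W \<longleftrightarrow> u e \<in> W \<and> v e \<in> W" if "e \<in> edges G" for e
      using ends[OF that] by simp
    then have "P \<subseteq> {e \<in> edges G. e \<inter> vertices G \<subseteq> W} \<longleftrightarrow>
        P \<subseteq> edges G \<and> (\<forall>e\<in>P. u e \<in> W \<and> v e \<in> W)"
      by blast
    moreover have "vertices G \<inter> W = (W \<inter> U) \<union> (W \<inter> V)" using UV(1) by blast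
    ultimately show ?thesis unfolding perfect_matching_def induced_subgraph_def by (simp add: ball_Un)
  qed
  also have "\<dots> \<longleftrightarrow> P \<subseteq> edges G \<and> (\<forall>e\<in>P. u e \<in> W \<and> v e \<in> W) \<and>
      (\<forall>x\<in>W \<inter> U. \<exists>!e. e \<in> P \<and> x = u e) \<and> (\<forall>x\<in>W \<inter> V. \<exists>!e. e \<in> P \<and> x = v e)"
    using in_edge by (intro conj_cong ball_cong refl arg_cong[where f = Ex1] ext) auto
  also have "\<dots> \<longleftrightarrow>
      P \<subseteq> edges G \<and> inj_on u P \<and> inj_on v P \<and> u ` P = W \<inter> U \<and> v ` P = W \<inter> V"
  proof -
    have side: "(\<forall>e\<in>P. f e \<in> W) \<and> (\<forall>x\<in>W \<inter> Z. \<exists>!e. e \<in> P \<and> x = f e) \<longleftrightarrow> inj_on f P \<and> f ` P = W \<inter> Z"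
      if "\<And>e. e \<in> P \<Longrightarrow> f e \<in> Z" for f :: "complex set \<Rightarrow> complex" and Z
    proof
      assume L: "(\<forall>e\<in>P. f e \<in> W) \<and> (\<forall>x\<in>W \<inter> Z. \<exists>!e. e \<in> P \<and> x = f e)"
      then have "inj_on f P" using L that by (intro inj_onI) (metis IntI)
      moreover have "f ` P = W \<inter> Z" using L that by blast
      ultimately show "inj_on f P \<and> f ` P = W \<inter> Z" ..
    next
      assume R: "inj_on f P \<and> f ` P = W \<inter> Z"
      then have "\<exists>!e. e \<in> P \<and> x = f e" if "x \<in> W \<inter> Z" for x
        using that by (metis imageE inj_onD)
      then show "(\<forall>e\<in>P. f e \<in> W) \<and> (\<forall>x\<in>W \<inter> Z. \<exists>!e. e \<in> P \<and> x = f e)"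
        using R by blast
    qed
    show ?thesis
    proof (cases "P \<subseteq> edges G")
      case True
      then have "\<And>e. e \<in> P \<Longrightarrow> u e \<in> U" "\<And>e. e \<in> P \<Longrightarrow> v e \<in> V" using ends by auto
      from side[of u U, OF this(1)] side[of v V, OF this(2)] show ?thesis
        by (simp add: ball_conj_distrib) argo
    qed simp
  qed
  finally show ?thesis .
qed

locale plane_matched_bigraph = matched_bigraph U V L "edges G" \<mu> u v
  for U V L :: "complex set" and G :: graph and \<mu> :: "complex set set"
    and u v :: "complex set \<Rightarrow> complex" +
  assumes plane: "plane_graph G" and vertices: "U \<union> V = vertices G"
    and ends: "\<And>e. e \<in> edges G \<Longrightarrow> e \<inter> vertices G = {u e, v e}"
begin

text \<open>Nodes become sets in the plane, so that a path of a linking sweeps out a connected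
  set.\<close>

definition points :: "complex + complex set \<Rightarrow> complex set" where
  "points z = (case z of Inl x \<Rightarrow> {x} | Inr e \<Rightarrow> e)"

lemma points_simps [simp]: "points (Inl x) = {x}" "points (Inr e) = e"
  by (simp_all add: points_def)

lemma path_connected_points: "z \<in> nodes \<Longrightarrow> path_connected (points z)"
proof -
  have "path_connected e" if "e \<in> edges G" for e
  proof -
    have "\<exists>g. arc g \<and> path_image g = e \<and> e \<inter> vertices G = {pathstart g, pathfinish g}"
      using plane that by (simp add: plane_graph_def)
    then obtain g where "arc g" "path_image g = e" by blast
    then show ?thesis using path_connected_path_image[OF arc_imp_path] by metis
  qed
  then show "z \<in> nodes \<Longrightarrow> path_connected (points z)" by (auto simp: nodes_def)
qed

lemma edge_ends: "e \<in> edges G \<Longrightarrow> e \<inter> vertices G = {tail e, head e}"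
  using ends by (auto simp: tail_def head_def)

lemma points_step: "step x y \<Longrightarrow> points x \<inter> points y \<noteq> {}"
  using edge_ends by (fastforce simp: step_def)

lemma edges_disjoint: "e \<in> edges G \<Longrightarrow> f \<in> edges G \<Longrightarrow> e \<noteq> f \<Longrightarrow> e \<inter> f \<subseteq> vertices G"
  using plane by (auto simp: plane_graph_def)

text \<open>Following \<open>p\<close> from each \<open>as ! i\<close> to its first end point sweeps
  out disjoint connected sets that touch the disc only at their two ends. As these cannot cross, the
  path from \<open>as ! i\<close> leads to \<open>bs ! i\<close>, and the cycle through
  \<open>bs ! i\<close> closes before it meets another end point.\<close>

lemma links_meet_sources_once:
  assumes len: "length as = n" "length bs = n"
    and sub: "set as \<subseteq> vertices G" "set bs \<subseteq> vertices G" and dist: "distinct (as @ rev bs)"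
    and F: "F \<in> faces G" and cyc: "in_cyclic_order_on_face (as @ rev bs) F"
    and \<sigma>: "\<And>i. i < n \<Longrightarrow> \<sigma> (bs ! i) = as ! i"
    and p: "p \<in> links (set bs) \<sigma>"
    and xy: "x \<in> Inl ` set bs" "y \<in> Inl ` set bs" "(p ^^ k) x = y"
  shows "x = y"
proof -
  let ?B = "Inl ` set bs :: (complex + complex set) set"
  note pN = linkings_permutes[OF p]
  note p_eq = inj_eq[OF permutes_inj[OF pN]]
  have pk_eq: "(p ^^ j) w = (p ^^ j) z \<longleftrightarrow> w = z" for j w z
    using permutes_inj[OF pN] by (simp add: inj_eq inj_fn)

  \<comment> \<open>Walks from the starts to their first end points\<close>
  define walk where "walk i j = (p ^^ j) (Inl (as ! i))" for i j
  have walk_0: "walk i 0 = Inl (as ! i)" and walk_Suc: "walk i (Suc j) = p (walk i j)" for i j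
    by (simp_all add: walk_def)
  have p_bs: "p (Inl (bs ! i)) = Inl (as ! i)" if "i < n" for i
    using links_source[OF p, of "bs ! i"] \<sigma>[OF that] that len by simp
  have in_bs: "Inl (bs ! i) \<in> ?B" if "i < n" for i using that len by auto
  have walk_nodes: "walk i j \<in> nodes" if "i < n" for i j
  proof (induction j)
    case 0
    have "as ! i \<in> U \<union> V" using that len sub(1) nth_mem[of i as] unfolding vertices by blast
    then show ?case unfolding walk_0 nodes_def by blast
  next
    case (Suc j)
    then show ?case using permutes_in_image[OF pN] by (simp add: walk_Suc)
  qed
  have hits: "\<exists>j. walk i j \<in> ?B" if "i < n" for i
  proof -
    \<comment> \<open>As \<open>p ^^ N = id\<close> and \<open>p\<close> maps \<open>bs ! i\<close>
      to \<open>as ! i\<close>, the walk is at \<open>bs ! i\<close> after \<open>N - 1\<close>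
      steps.\<close>
    obtain N where N: "p ^^ N = id" "N > 0"
      using permutation_is_nilpotent[OF permutes_imp_permutation[OF finite_nodes pN]] by auto
    then obtain N' where "N = Suc N'" by (cases N) auto
    then have "(p ^^ N') (p (Inl (bs ! i))) = Inl (bs ! i)"
      using N(1) by (simp add: funpow_swap1 fun_eq_iff)
    then have "walk i N' \<in> ?B" using p_bs[OF that] in_bs[OF that] by (simp add: walk_def)
    then show ?thesis ..
  qed
  define ln where "ln i = (LEAST j. walk i j \<in> ?B)" for i
  have walk_ln: "walk i (ln i) \<in> ?B" if "i < n" for i
    unfolding ln_def using hits[OF that] by (rule LeastI_ex)
  have walk_less: "walk i j \<notin> ?B" if "j < ln i" for i j
    using that not_less_Least unfolding ln_def by blast
  have "\<exists>m<n. walk i (ln i) = Inl (bs ! m)" if "i < n" for i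
    using walk_ln[OF that] len by (auto simp: in_set_conv_nth)
  then obtain \<rho> where \<rho>: "\<rho> i < n" "walk i (ln i) = Inl (bs ! \<rho> i)" if "i < n" for i
    by metis
  \<comment> \<open>Cancelling \<open>j\<close> steps puts \<open>as ! i\<close> on walk
    \<open>l\<close> at time \<open>k - j\<close>. Were this time positive, its predecessor
    \<open>bs ! i\<close> would be an end point on that walk before time
    \<open>ln l\<close>.\<close>
  have start: "i = l" if "i < n" "l < n" "j \<le> k" "k \<le> ln l" "walk i j = walk l k" for i l j k
  proof -
    have "(p ^^ j) (walk i 0) = (p ^^ j) (walk l (k - j))"
      using that(3,5) by (simp add: walk_def funpow_add[symmetric, unfolded o_def fun_eq_iff, rule_format])
    then have eq: "Inl (as ! i) = walk l (k - j)" by (simp add: pk_eq walk_0)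
    show ?thesis
    proof (cases "k - j")
      case 0
      then have "as ! i = as ! l" using eq by (simp add: walk_0)
      then show ?thesis using dist that len by (simp add: nth_eq_iff_index_eq)
    next
      case (Suc m)
      then have "p (Inl (bs ! i)) = p (walk l m)" using eq p_bs[OF that(1)] by (simp add: walk_Suc)
      then have "walk l m \<in> ?B" using in_bs[OF that(1)] by (simp add: p_eq)
      moreover have "m < ln l" using Suc that(4) by simp
      ultimately show ?thesis using walk_less by blast
    qed
  qed
  define S where "S i = walk i ` {..ln i}" for i
  have S_disj: "S i \<inter> S l = {}" if "i < n" "l < n" "i \<noteq> l" for i l
  proof (rule ccontr)
    assume "S i \<inter> S l \<noteq> {}"
    then obtain j k where "j \<le> ln i" "k \<le> ln l" "walk i j = walk l k" by (auto simp: S_def)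
    then show False using start[of i l j k] start[of l i k j] that by (metis nat_le_linear)
  qed
  have \<rho>_inj: "i = l" if "i < n" "l < n" "\<rho> i = \<rho> l" for i l
  proof (rule ccontr)
    assume "i \<noteq> l"
    then have "S i \<inter> S l = {}" using S_disj that by blast
    moreover have "walk i (ln i) \<in> S i" "walk l (ln l) \<in> S l" by (auto simp: S_def)
    ultimately show False using \<rho>[OF that(1)] \<rho>[OF that(2)] that(3) by auto
  qed
  have S_nodes: "S i \<subseteq> nodes" if "i < n" for i using walk_nodes[OF that] by (auto simp: S_def)

  \<comment> \<open>Plane regions swept out by the walks\<close>
  define region where "region i = \<Union> (points ` S i)" for i
  \<comment> \<open>An edge on the walk was entered from its tail, and it is not the last node since
    walks end in vertices, so both its ends lie on the walk.\<close>
  have vertex_in_S: "Inl x \<in> S i" if i: "i < n" and x: "x \<in> vertices G" "x \<in> points z" "z \<in> S i" for i x z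
  proof (cases z)
    case (Inl x')
    then show ?thesis using x by auto
  next
    case (Inr e)
    then have e: "e \<in> edges G" using S_nodes[OF i] x by (auto simp: nodes_def)
    obtain j where j: "j \<le> ln i" "walk i j = Inr e" using x(3) Inr by (auto simp: S_def)
    have "p (Inr e) \<noteq> Inr e"
    proof
      assume "p (Inr e) = Inr e"
      then have "(p ^^ j) (Inr e) = Inr e" by (induction j) auto
      then have "(p ^^ j) (Inr e) = (p ^^ j) (Inl (as ! i))" using j by (simp add: walk_def)
      then show False by (simp add: pk_eq)
    qed
    then have moved: "e \<in> moved p" using e by (simp add: moved_def)
    have "j \<noteq> 0" using j(2) walk_0[of i] by (metis sum.distinct(1))
    then obtain j' where j': "j = Suc j'" by (cases j) auto
    have "p (walk i j') = p (Inl (tail e))"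
      using j(2) moved_tail[OF p moved] by (simp add: j' walk_Suc)
    then have "walk i j' = Inl (tail e)" by (simp add: p_eq)
    moreover have "walk i j' \<in> S i" unfolding S_def using j(1) j' by (intro imageI) simp
    ultimately have "Inl (tail e) \<in> S i" by simp
    moreover have "j < ln i" using j walk_ln[OF i] by (cases "j = ln i") auto
    then have "walk i (Suc j) \<in> S i" unfolding S_def by (intro imageI) simp
    then have "Inl (head e) \<in> S i" using moved_head[OF p moved] j(2) by (simp add: walk_Suc)
    moreover have "x = tail e \<or> x = head e" using edge_ends[OF e] x Inr by auto
    ultimately show ?thesis by auto
  qed
  \<comment> \<open>Distinct edges meet only in vertices, so a common point would be a vertex on
    both walks.\<close>
  have region_disj: "region i \<inter> region l = {}" if il: "i < n" "l < n" "i \<noteq> l" for i l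
  proof (rule ccontr)
    assume "region i \<inter> region l \<noteq> {}"
    then obtain x z z' where x: "x \<in> points z" "z \<in> S i" "x \<in> points z'" "z' \<in> S l"
      by (auto simp: region_def)
    have zz: "z \<in> nodes" "z' \<in> nodes" "z \<noteq> z'" using x S_nodes S_disj il by blast+
    have "x \<in> vertices G"
    proof (cases z; cases z')
      fix e f assume "z = Inr e" "z' = Inr f"
      then show ?thesis using x zz edges_disjoint[of e f] by (auto simp: nodes_def)
    qed (use x zz vertices in \<open>auto simp: nodes_def\<close>)
    then have "Inl x \<in> S i" "Inl x \<in> S l" using vertex_in_S il x by blast+
    then show False using S_disj[OF il] by auto
  qed
  have region_connected: "path_connected (region i)" if i: "i < n" for i
  proof -
    have "path_connected (\<Union> (points ` walk i ` {..j}))" if "j \<le> ln i" for j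
      using that
    proof (induction j)
      case 0
      then show ?case using path_connected_points walk_nodes[OF i] by simp
    next
      case (Suc j)
      have "walk i j \<notin> ?B" using Suc.prems by (intro walk_less) simp
      then have "p (walk i j) = walk i j \<or> step (walk i j) (p (walk i j))"
        using p walk_nodes[OF i] by (auto simp: linkings_def)
      moreover have "points z \<noteq> {}" if "z \<in> nodes" for z
        using that edge_ends by (fastforce simp: nodes_def)
      ultimately have "points (walk i j) \<inter> points (walk i (Suc j)) \<noteq> {}"
        using points_step walk_nodes[OF i] unfolding walk_Suc by (metis inf.idem)
      then have "\<Union> (points ` walk i ` {..j}) \<inter> points (walk i (Suc j)) \<noteq> {}" by auto
      moreover have "path_connected (\<Union> (points ` walk i ` {..j}))" using Suc by simp
      ultimately have "path_connected (\<Union> (points ` walk i ` {..j}) \<union> points (walk i (Suc j)))"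
        using path_connected_points[OF walk_nodes[OF i]] by (intro path_connected_Un)
      then show ?case by (simp add: atMost_Suc Un_commute)
    qed
    then show ?thesis by (simp add: region_def S_def)
  qed

  \<comment> \<open>The disc in the face and the order of the end points\<close>
  have "length (as @ rev bs) = 2 * n" using len by simp
  then obtain h t where h: "continuous_on (cball 0 1) h" "inj_on h (cball 0 1)"
    and t_mono: "strict_mono_on {..<2 * n} t"
    and t: "\<And>k. k < 2 * n \<Longrightarrow> 0 \<le> t k \<and> t k < 2 * pi \<and> h (cis (t k)) = (as @ rev bs) ! k"
    and hF: "h ` (cball 0 1 - (\<lambda>k. cis (t k)) ` {..<2 * n}) \<subseteq> F"
    using cyc unfolding in_cyclic_order_on_face_def by (metis (no_types, lifting))
  have F_graph: "F \<inter> (vertices G \<union> \<Union> (edges G)) = {}"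
    using F in_components_subset unfolding faces_def by blast
  \<comment> \<open>The face avoids the graph, so a region touches the disc only in listed points.
    On walk \<open>i\<close> only the last node is an end point and, by \<open>start\<close>, only
    \<open>as ! i\<close> is a start.\<close>
  have region_disc: "region i \<inter> h ` cball 0 1 \<subseteq> {as ! i, bs ! \<rho> i}" if i: "i < n" for i
  proof
    fix y assume y: "y \<in> region i \<inter> h ` cball 0 1"
    then obtain z where z: "z \<in> S i" "y \<in> points z" by (auto simp: region_def)
    have "points z \<subseteq> vertices G \<union> \<Union> (edges G)"
      using z S_nodes[OF i] vertices by (auto simp: nodes_def)
    then have "y \<notin> F" using z F_graph by blast
    moreover obtain w where w: "w \<in> cball 0 1" "y = h w" using y by blast
    ultimately have "w \<in> (\<lambda>k. cis (t k)) ` {..<2 * n}" using hF by blast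
    then obtain k where k: "k < 2 * n" "w = cis (t k)" by auto
    then have "y = (as @ rev bs) ! k" using t w by simp
    then have y_in: "y \<in> set as \<union> set bs"
      using nth_mem[of k "as @ rev bs"] k len by simp
    then have "Inl y \<in> S i" using vertex_in_S[OF i _ z(2,1)] sub by blast
    then obtain j where j: "j \<le> ln i" "walk i j = Inl y" by (auto simp: S_def)
    show "y \<in> {as ! i, bs ! \<rho> i}"
    proof (cases "y \<in> set bs")
      case True
      then have "\<not> j < ln i" using walk_less[of j i] j(2) by auto
      then have "Inl y = (Inl (bs ! \<rho> i) :: complex + complex set)" using j \<rho>[OF i] by simp
      then show ?thesis by simp
    next
      case False
      then obtain l where l: "l < n" "y = as ! l" using y_in len by (auto simp: in_set_conv_nth)
      then have "walk l 0 = walk i j" using j(2) by (simp add: walk_0)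
      then have "l = i" using start[of l i 0 j] l i j by simp
      then show ?thesis using l by simp
    qed
  qed
  have ends_in_region: "as ! i \<in> region i" "bs ! \<rho> i \<in> region i" if "i < n" for i
  proof -
    have "walk i 0 \<in> S i" "walk i (ln i) \<in> S i" by (auto simp: S_def)
    then show "as ! i \<in> region i" "bs ! \<rho> i \<in> region i"
      using \<rho>[OF that] by (force simp: region_def walk_0)+
  qed
  have \<rho>_mono: "\<rho> i < \<rho> l" if il: "i < l" "l < n" for i l
  proof (rule ccontr)
    assume "\<not> \<rho> i < \<rho> l"
    then have less: "\<rho> l < \<rho> i" using \<rho>_inj[of i l] il by (cases "\<rho> i = \<rho> l") auto
    have i: "i < n" using il by simp
    \<comment> \<open>The position of \<open>bs ! m\<close> in \<open>as @ rev bs\<close> is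
      \<open>2 * n - 1 - m\<close>, counted from 0. An inversion of \<open>\<rho>\<close> makes the
      ends of the two regions alternate on the circle.\<close>
    define i' l' where "i' = 2 * n - 1 - \<rho> i" and "l' = 2 * n - 1 - \<rho> l"
    have ord: "i < l" "l < i'" "i' < l'" "l' < 2 * n"
      using il less \<rho>(1)[OF i] by (auto simp: i'_def l'_def)
    have at: "h (cis (t i)) = as ! i" "h (cis (t l)) = as ! l"
      "h (cis (t i')) = bs ! \<rho> i" "h (cis (t l')) = bs ! \<rho> l"
      using t[of i] t[of l] t[of i'] t[of l'] ord il i len \<rho>(1)[OF i] \<rho>(1)[OF il(2)]
      by (auto simp: nth_append i'_def l'_def rev_nth)
    have "region i \<inter> region l \<noteq> {}"
    proof (rule disc_crossing[OF h, of "t i" "t l" "t i'" "t l'"])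
      show "0 \<le> t i" "t l' < 2 * pi" using t[of i] t[of l'] ord by auto
      show "t i < t l" "t l < t i'" "t i' < t l'"
        using ord strict_mono_onD[OF t_mono] by auto
      show "connected (region l)"
        by (rule path_connected_imp_connected[OF region_connected[OF il(2)]])
    qed (use at region_connected ends_in_region region_disc i il in auto)
    then show False using region_disj[OF i il(2)] il by simp
  qed
  \<comment> \<open>A strictly increasing map from \<open>{..<n}\<close> to itself is the identity.\<close>
  have \<rho>_add: "i + d < n \<Longrightarrow> \<rho> i + d \<le> \<rho> (i + d)" for i d
  proof (induction d)
    case (Suc d)
    then show ?case using \<rho>_mono[of "i + d" "i + Suc d"] by simp
  qed simp
  have \<rho>_id: "\<rho> i = i" if "i < n" for i
  proof (rule antisym)
    show "i \<le> \<rho> i" using \<rho>_add[of 0 i] that by simp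
    show "\<rho> i \<le> i" using \<rho>_add[of i "n - 1 - i"] \<rho>(1)[of "n - 1"] that by simp
  qed
  obtain i where i: "i < n" "x = Inl (bs ! i)" using xy(1) len by (auto simp: in_set_conv_nth)
  \<comment> \<open>The step from \<open>bs ! i\<close> to \<open>as ! i\<close> comes first, so
    time \<open>j\<close> on the walk is the power \<open>Suc j\<close>, and \<open>p\<close>
    returns to \<open>x\<close> after \<open>Suc (ln i)\<close> steps. Only the remainder of
    \<open>k\<close> matters.\<close>
  have pow: "(p ^^ Suc j) x = walk i j" for j
    using p_bs[OF i(1)] i(2) by (simp add: walk_def funpow_swap1)
  have "(p ^^ Suc (ln i)) x = x" unfolding pow using \<rho>[OF i(1)] \<rho>_id i by simp
  then have y: "y = (p ^^ (k mod Suc (ln i))) x" using xy(3) by (simp only: funpow_mod_eq)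
  show "x = y"
  proof (cases "k mod Suc (ln i)")
    case 0
    then show ?thesis using y by simp
  next
    case (Suc j)
    then have "j < ln i" using mod_less_divisor[of "Suc (ln i)" k] by simp
    moreover have "y = walk i j" using y pow Suc by simp
    ultimately show ?thesis using walk_less xy(2) by auto
  qed
qed

end

section \<open>The determinant formula\<close>

theorem theorem4p1:
  fixes G :: graph and U V F :: "complex set" and as bs :: "complex list" and n :: nat
  assumes "plane_graph G"
    and "bipartite G U V"
    and "n \<ge> 1" and "length as = n" and "length bs = n"
    and "set as \<subseteq> vertices G" and "set bs \<subseteq> vertices G"
    and "distinct (as @ rev bs)"
    and "F \<in> faces G"
    and "in_cyclic_order_on_face (as @ rev bs) F"
    and "num_perfect_matchings (graph_L G U V (set as) (set bs)) = 1"
  shows "int (num_perfect_matchings (graph_K G U V (set as) (set bs))) =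
    Determinant.det (Matrix.mat n n (\<lambda>(i, j).
      int (num_perfect_matchings (graph_L_entry G U V (set as) (set bs) (as ! i) (bs ! j)))))"
proof -
  let ?A = "set as" and ?B = "set bs"
  define W where "W = vertices G - (?A \<inter> U) - (?B \<inter> V)"
  have UV: "U \<union> V = vertices G" "U \<inter> V = {}" using assms(2) by (auto simp: bipartite_def)
  have AB: "?A \<inter> ?B = {}" using assms(8) by auto
  have L: "graph_L G U V ?A ?B = induced_subgraph G W"
    unfolding graph_L_def delete_vertices_eq_induced[of G] delete_vertices_induced W_def
    by (rule arg_cong[where f = "induced_subgraph G"]) blast
  have vertices_L: "vertices (graph_L G U V ?A ?B) = W"
    unfolding L vertices_induced_subgraph W_def by blast
  obtain u v where uv: "\<And>e. e \<in> edges G \<Longrightarrow> u e \<in> U \<and> v e \<in> V \<and> e \<inter> vertices G = {u e, v e}"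
    using assms(2) unfolding bipartite_def by metis
  have pm_iff: "perfect_matching (induced_subgraph G X) P \<longleftrightarrow>
      P \<subseteq> edges G \<and> inj_on u P \<and> inj_on v P \<and> u ` P = X \<inter> U \<and> v ` P = X \<inter> V" for X P
    by (rule perfect_matching_induced_iff[OF UV uv])
  obtain \<mu> where \<mu>: "perfect_matching (induced_subgraph G W) \<mu>"
    using assms(11) unfolding num_perfect_matchings_def L
    by (metis card_1_singletonE mem_Collect_eq singletonI)
  interpret plane_matched_bigraph U V W G \<mu> u v
    using assms(1) UV uv \<mu> unfolding pm_iff by unfold_locales (auto simp: plane_graph_def)
  have count: "num_perfect_matchings (induced_subgraph G X) = card (matchings X)" for X
    unfolding num_perfect_matchings_def matchings_def pm_iff ..
  have card_links: "num_perfect_matchings (induced_subgraph G (exchange A B)) = card (links B \<sigma>)"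
    if "A \<subseteq> ?A" "B \<subseteq> ?B" "bij_betw \<sigma> B A" for A B \<sigma>
    unfolding count
    by (rule card_matchings_eq_card_links) (use that assms(6,7) UV AB in \<open>auto simp: W_def\<close>)
  \<comment> \<open>The vertex set of \<open>L\<close> is \<open>exchange {} {}\<close>, so
    uniqueness of its matching says that there are no directed cycles.\<close>
  have "card (links {} id) = 1"
    using card_links[of "{}" "{}" id] assms(11) unfolding L by (simp add: exchange_def)
  moreover have "id \<in> links {} id" by (simp add: linkings_def permutes_id)
  ultimately have trivial: "links {} id = {id}" by (metis card_1_singletonE singletonD)
  define \<sigma> where "\<sigma> = (\<lambda>b. as ! inv_into {..<n} ((!) bs) b)"
  have bs_bij: "bij_betw ((!) bs) {..<n} ?B" and as_bij: "bij_betw ((!) as) {..<n} ?A"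
    using assms(4,5,8) by (auto intro: bij_betw_nth)
  have \<sigma>_nth: "\<sigma> (bs ! i) = as ! i" if "i < n" for i
    using that bs_bij by (simp add: \<sigma>_def bij_betw_inv_into_left)
  have \<sigma>: "bij_betw \<sigma> ?B ?A"
    using bij_betw_trans[OF bij_betw_inv_into[OF bs_bij] as_bij] by (simp add: \<sigma>_def comp_def)
  \<comment> \<open>Among the vertices of \<open>A\<close> and \<open>B\<close>, the graph
    \<open>K\<close> has precisely those that \<open>L\<close> lacks, so it is the full
    exchange.\<close>
  have "graph_K G U V ?A ?B = induced_subgraph G (exchange ?A ?B)"
    unfolding graph_K_def delete_vertices_eq_induced[of G] delete_vertices_induced exchange_def
    unfolding W_def
  proof (rule arg_cong[where f = "induced_subgraph G"], rule Set.set_eqI)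
    fix x
    have "x \<in> vertices G \<longleftrightarrow> x \<in> U \<or> x \<in> V" "\<not> (x \<in> U \<and> x \<in> V)" "\<not> (x \<in> ?A \<and> x \<in> ?B)"
      "x \<in> ?A \<longrightarrow> x \<in> vertices G" "x \<in> ?B \<longrightarrow> x \<in> vertices G"
      using UV AB assms(6,7) by blast+
    then show "x \<in> vertices G \<inter> (vertices G - ?A \<inter> V) - ?B \<inter> U \<longleftrightarrow>
        x \<in> vertices G - ?A \<inter> U - ?B \<inter> V - (?A \<union> ?B) \<union> ?A \<inter> U \<union> ?B \<inter> V"
      unfolding Un_iff Int_iff Diff_iff by argo
  qed
  then have "int (num_perfect_matchings (graph_K G U V ?A ?B)) = int (card (links ?B \<sigma>))"
    using card_links[OF _ _ \<sigma>] by simp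
  also have "\<dots> = set_det (Inl ` ?B)
      (\<lambda>x y. int (card (linkings nodes step {y} (\<lambda>_. map_sum \<sigma> id x))))"
  proof (rule card_linkings_eq_det_card_linkings[OF finite_nodes])
    have "\<sigma> ` ?B = ?A" using \<sigma> by (simp add: bij_betw_def)
    then have "\<sigma> b \<in> U \<union> V" if "b \<in> ?B" for b using that assms(6) UV(1) by blast
    then show "map_sum \<sigma> id ` Inl ` ?B \<subseteq> nodes" by (auto simp: nodes_def)
    show "Inl ` ?B \<subseteq> nodes" using assms(7) UV(1) by (auto simp: nodes_def)
    show "linkings nodes step {} (map_sum id id) = {id}" using trivial by simp
  qed (use links_meet_sources_once[OF assms(4-10) \<sigma>_nth] in blast)
  also have "\<dots> = Determinant.det (Matrix.mat n n (\<lambda>(i, j).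
      int (card (linkings nodes step {Inl (bs ! j)} (\<lambda>_. map_sum \<sigma> id (Inl (bs ! i)))))))"
  proof (rule set_det_enum)
    show "bij_betw (\<lambda>i. Inl (bs ! i)) {0..<n} (Inl ` ?B)"
      using bij_betw_trans[OF bs_bij, of Inl "Inl ` ?B"]
      by (simp add: comp_def lessThan_atLeast0 bij_betw_def)
  qed
  also have "\<dots> = Determinant.det (Matrix.mat n n (\<lambda>(i, j).
      int (num_perfect_matchings (graph_L_entry G U V ?A ?B (as ! i) (bs ! j)))))"
  proof (rule arg_cong[where f = Determinant.det], rule cong_mat)
    fix i j assume ij: "i < n" "j < n"
    then have ab: "as ! i \<in> ?A" "bs ! j \<in> ?B" using assms(4,5) by auto
    then have ne: "as ! i \<noteq> bs ! j" "as ! i \<in> U \<union> V" "bs ! j \<in> U \<union> V" using AB assms(6,7) UV by auto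
    \<comment> \<open>Each of the four cases toggles the membership of \<open>as ! i\<close> and
      \<open>bs ! j\<close> in \<open>L\<close>, which is what the exchange does.\<close>
    have "graph_L_entry G U V ?A ?B (as ! i) (bs ! j) =
        induced_subgraph G (exchange {as ! i} {bs ! j})"
    proof -
      have "delete_vertices (graph_L G U V ?A ?B) S = induced_subgraph G (W - S)" for S
        unfolding L delete_vertices_induced
        by (rule arg_cong[where f = "induced_subgraph G"]) (auto simp: W_def)
      then show ?thesis
        unfolding graph_L_entry_def Let_def vertices_L exchange_def
        using ne UV(2) by (auto intro!: arg_cong[where f = "induced_subgraph G"])
    qed
    moreover have "linkings nodes step {Inl (bs ! j)} (\<lambda>_. map_sum \<sigma> id (Inl (bs ! i))) =
        links {bs ! j} (\<lambda>_. as ! i)"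
      unfolding image_insert image_empty by (rule linkings_cong) (simp add: \<sigma>_nth[OF ij(1)])
    ultimately show "(case (i, j) of (i, j) \<Rightarrow>
          int (card (linkings nodes step {Inl (bs ! j)} (\<lambda>_. map_sum \<sigma> id (Inl (bs ! i)))))) =
        (case (i, j) of (i, j) \<Rightarrow>
          int (num_perfect_matchings (graph_L_entry G U V ?A ?B (as ! i) (bs ! j))))"
      using card_links[of "{as ! i}" "{bs ! j}" "\<lambda>_. as ! i"] ab by (simp add: bij_betw_def)
  qed simp_all
  finally show ?thesis .
qed

end
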